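(* Let $\Omega\subset\mathbb{C}$ be a domain and let $M$ be a Riemann surface admitting an exhaustion $M=\bigcup_{j=1}^{\infty}M_j$ by open subsets $M_1\subset M_2\subset\cdots$, each $M_j$ biholomorphic to $\Omega$. \begin{enumerate} \item[(i)] If $\Omega=\Delta=\{|z|<1\}$, then $M$ is biholomorphic either to $\Delta$ or to $\mathbb{C}$. \item[(ii)] If $\Omega=\{z\in\mathbb{C}: r<|z|<1\}$ for some $0<r<1$, then $M$ is biholomorphic to one of $\Omega$, $\Delta$, or $\mathbb{C}$. \item[(iii)] If $\Omega=\mathbb{C}$, then $M$ is biholomorphic to $\mathbb{C}$. \item[(iv)] If $\Omega=\mathbb{C}\setminus\{a_1,\ldots,a_n\}$ with $n\ge 1$ and $a_1,\ldots,a_n$ distinct points of $\mathbb{C}$, then $M$ is biholomorphic to $\Omega$. \end{enumerate}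
   Context: A Riemann surface is a connected one-dimensional complex manifold. *)

theory Defs
  imports "HOL-Complex_Analysis.Complex_Analysis"
begin

type_synonym 'a chart = "'a set \<times> ('a \<Rightarrow> complex)"

definition is_chart :: "'a topology \<Rightarrow> 'a chart \<Rightarrow> bool" where
  "is_chart X c \<longleftrightarrow> (case c of (U, \<phi>) \<Rightarrow>
      openin X U \<and> open (\<phi> ` U) \<and>
      homeomorphic_map (subtopology X U) (top_of_set (\<phi> ` U)) \<phi>)"

definition holomorphic_atlas :: "'a topology \<Rightarrow> 'a chart set \<Rightarrow> bool" where
  "holomorphic_atlas X A \<longleftrightarrow>
     (\<forall>c\<in>A. is_chart X c) \<and>
     (\<forall>x\<in>topspace X. \<exists>(U, \<phi>)\<in>A. x \<in> U) \<and>
     (\<forall>(U, \<phi>)\<in>A. \<forall>(V, \<psi>)\<in>A.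
        (\<psi> \<circ> inv_into U \<phi>) holomorphic_on (\<phi> ` (U \<inter> V)))"

definition riemann_surface :: "'a topology \<Rightarrow> 'a chart set \<Rightarrow> bool" where
  "riemann_surface X A \<longleftrightarrow>
     Hausdorff_space X \<and> connected_space X \<and> holomorphic_atlas X A"

definition holomorphic_map ::
  "'a topology \<Rightarrow> 'a chart set \<Rightarrow> 'b topology \<Rightarrow> 'b chart set \<Rightarrow> ('a \<Rightarrow> 'b) \<Rightarrow> bool" where
  "holomorphic_map X A Y B f \<longleftrightarrow>
     continuous_map X Y f \<and>
     (\<forall>(U, \<phi>)\<in>A. \<forall>(V, \<psi>)\<in>B.
        (\<psi> \<circ> f \<circ> inv_into U \<phi>) holomorphic_on (\<phi> ` (U \<inter> {x \<in> topspace X. f x \<in> V})))"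

definition biholomorphic ::
  "'a topology \<Rightarrow> 'a chart set \<Rightarrow> 'b topology \<Rightarrow> 'b chart set \<Rightarrow> bool" where
  "biholomorphic X A Y B \<longleftrightarrow>
     (\<exists>f g. holomorphic_map X A Y B f \<and> holomorphic_map Y B X A g \<and>
        (\<forall>x\<in>topspace X. g (f x) = x) \<and> (\<forall>y\<in>topspace Y. f (g y) = y))"

definition restrict_atlas :: "'a chart set \<Rightarrow> 'a set \<Rightarrow> 'a chart set" where
  "restrict_atlas A W = {(U \<inter> W, \<phi>) | U \<phi>. (U, \<phi>) \<in> A}"

definition plane_atlas :: "complex set \<Rightarrow> complex chart set" where
  "plane_atlas \<Omega> = {(\<Omega>, id)}"

end

theory Submission
  imports Defs "HOL-Library.Diagonal_Subsequence"
begin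

text \<open>
  Comparing consecutive exhausting charts gives injective holomorphic transition maps
  \<open>T k : \<Omega> \<rightarrow> \<Omega>\<close>, and \<open>X\<close> is their direct limit. When every \<open>T k\<close> is onto, \<open>X\<close> is
  \<open>\<Omega>\<close>; this always happens if \<open>\<Omega>\<close> is the complement of a finite set, since a univalent map has at
  most poles at the punctures, so that its image omits no more points than \<open>\<Omega>\<close> does.

  In general the direct limit embeds in the plane: univalent functions with prescribed first order
  data at a point form a normal family, and a diagonal subsequence of the suitably normalised
  compositions of the \<open>T k\<close> converges to univalent functions \<open>H k\<close> with
  \<open>H (k + 1) \<circ> T k = H k\<close>. So \<open>X\<close> is the planar domain \<open>G\<close>, the union of the images of the \<open>H k\<close>.
  If \<open>G\<close> is simply connected, the Riemann mapping theorem applies. If not, and \<open>\<Omega>\<close> is an annulus,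
  a loop in \<open>G\<close> winds around a point outside \<open>G\<close>, which forces the \<open>T k\<close> for large \<open>k\<close> to be
  homotopically nontrivial; a nontrivial holomorphic self-map of an annulus is onto, because a limit
  of its iterates is not constant and a limit of differences of iterates is therefore the identity.
\<close>

section \<open>Holomorphic maps between surfaces\<close>

lemma is_chart_open_image:
  assumes "is_chart X (U, \<phi>)" "openin X N" "N \<subseteq> U"
  shows "open (\<phi> ` N)"
proof -
  have U: "openin X U" "open (\<phi> ` U)"
    and hom: "homeomorphic_map (subtopology X U) (top_of_set (\<phi> ` U)) \<phi>"
    using assms(1) by (auto simp: is_chart_def)
  have "openin (subtopology X U) N"
    using assms by (simp add: openin_open_subtopology U)
  with hom have "openin (top_of_set (\<phi> ` U)) (\<phi> ` N)"
    using homeomorphic_imp_open_map open_map_def by blast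
  with U show ?thesis
    using openin_open_eq by blast
qed

lemma is_chart_inj_on: "is_chart X (U, \<phi>) \<Longrightarrow> inj_on \<phi> U"
  by (auto simp: is_chart_def dest!: homeomorphic_imp_injective_map openin_subset
      simp: Int_absorb1)

lemma is_chart_subset: "is_chart X (U, \<phi>) \<Longrightarrow> U \<subseteq> topspace X"
  by (simp add: is_chart_def openin_subset)

lemma is_chart_restrict:
  assumes "is_chart X (U, \<phi>)" "openin X W"
  shows "is_chart (subtopology X W) (U \<inter> W, \<phi>)"
proof -
  have U: "openin X U"
    and hom: "homeomorphic_map (subtopology X U) (top_of_set (\<phi> ` U)) \<phi>"
    using assms(1) by (auto simp: is_chart_def)
  have "homeomorphic_map (subtopology (subtopology X U) (U \<inter> W))
          (subtopology (top_of_set (\<phi> ` U)) (\<phi> ` (U \<inter> W))) \<phi>"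
    using homeomorphic_map_subtopologies[OF hom, of "U \<inter> W" "\<phi> ` (U \<inter> W)"]
          is_chart_subset[OF assms(1)]
          is_chart_inj_on[OF assms(1)]
    by (auto simp: topspace_subtopology_subset openin_subset[OF U] Int_absorb1 Int_absorb2 image_mono)
  moreover have "subtopology (subtopology X U) (U \<inter> W) = subtopology (subtopology X W) (U \<inter> W)"
    by (simp add: subtopology_subtopology Int_ac)
  moreover have "subtopology (top_of_set (\<phi> ` U)) (\<phi> ` (U \<inter> W)) = top_of_set (\<phi> ` (U \<inter> W))"
    by (simp add: subtopology_subtopology Int_absorb1 image_mono)
  ultimately show ?thesis
    using is_chart_open_image[OF assms(1), of "U \<inter> W"] U assms(2)
    by (auto simp: is_chart_def openin_subtopology_Int)
qed

lemma holomorphic_atlas_chart: "holomorphic_atlas X A \<Longrightarrow> c \<in> A \<Longrightarrow> is_chart X c"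
  by (simp add: holomorphic_atlas_def)

lemma holomorphic_atlas_cover:
  assumes "holomorphic_atlas X A" "x \<in> topspace X"
  obtains U \<phi> where "(U, \<phi>) \<in> A" "x \<in> U"
proof -
  have "\<exists>(U, \<phi>)\<in>A. x \<in> U"
    using assms unfolding holomorphic_atlas_def by (elim conjE) (rule bspec)
  then show ?thesis using that by blast
qed

text \<open>Cutting a chart down to a smaller domain changes \<open>inv_into\<close>, but only off
  the smaller image. Every comparison of a chart with its restriction rests on this.\<close>

lemma inv_into_subset_eq:
  assumes "inj_on \<phi> U" "V \<subseteq> U" "z \<in> \<phi> ` V"
  shows "inv_into V \<phi> z = inv_into U \<phi> z"
proof -
  obtain x where x: "x \<in> V" "z = \<phi> x" using assms(3) by auto
  then show ?thesis
    using inv_into_f_f[OF inj_on_subset[OF assms(1,2)] x(1)] inv_into_f_f[OF assms(1)] assms(2)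
    by auto
qed

lemma holomorphic_atlas_restrict:
  assumes "holomorphic_atlas X A" "openin X W"
  shows "holomorphic_atlas (subtopology X W) (restrict_atlas A W)"
  unfolding holomorphic_atlas_def
proof (intro conjI ballI)
  fix c assume "c \<in> restrict_atlas A W"
  then obtain U \<phi> where "c = (U \<inter> W, \<phi>)" "(U, \<phi>) \<in> A"
    by (auto simp: restrict_atlas_def)
  then show "is_chart (subtopology X W) c"
    using assms is_chart_restrict holomorphic_atlas_chart by metis
next
  fix x assume "x \<in> topspace (subtopology X W)"
  then have "x \<in> topspace X" "x \<in> W" by auto
  then obtain U \<phi> where "(U, \<phi>) \<in> A" "x \<in> U"
    using assms holomorphic_atlas_cover by metis
  then show "\<exists>(U, \<phi>)\<in>restrict_atlas A W. x \<in> U"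
    using \<open>x \<in> W\<close> by (intro bexI[of _ "(U \<inter> W, \<phi>)"]) (auto simp: restrict_atlas_def)
next
  have tr: "(\<psi> \<circ> inv_into (U \<inter> W) \<phi>) holomorphic_on (\<phi> ` (U \<inter> W \<inter> (V \<inter> W)))"
    if "(U, \<phi>) \<in> A" "(V, \<psi>) \<in> A" for U \<phi> V \<psi>
  proof -
    have inj: "inj_on \<phi> U"
      using assms that by (auto simp: holomorphic_atlas_def is_chart_inj_on)
    have "(\<psi> \<circ> inv_into U \<phi>) holomorphic_on (\<phi> ` (U \<inter> V))"
      using assms(1) that by (fastforce simp: holomorphic_atlas_def)
    then have "(\<psi> \<circ> inv_into U \<phi>) holomorphic_on (\<phi> ` (U \<inter> W \<inter> (V \<inter> W)))"
      by (rule holomorphic_on_subset) auto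
    then show ?thesis
      by (rule holomorphic_transform)
         (auto simp: inv_into_subset_eq[OF inj, of "U \<inter> W"])
  qed
  fix c assume "c \<in> restrict_atlas A W"
  then show "case c of (U, \<phi>) \<Rightarrow> \<forall>(V, \<psi>)\<in>restrict_atlas A W.
      (\<psi> \<circ> inv_into U \<phi>) holomorphic_on \<phi> ` (U \<inter> V)"
    using tr unfolding restrict_atlas_def by blast
qed

lemma restrict_atlas_topspace:
  assumes "holomorphic_atlas X A"
  shows "restrict_atlas A (topspace X) = A"
proof -
  have "U \<inter> topspace X = U" if "(U, \<phi>) \<in> A" for U \<phi>
    using is_chart_subset[OF holomorphic_atlas_chart[OF assms that]] by auto
  then show ?thesis by (force simp: restrict_atlas_def)
qed

lemma holomorphic_mapD:
  assumes "holomorphic_map X A Y B f" "(U, \<phi>) \<in> A" "(V, \<psi>) \<in> B"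
  shows "(\<psi> \<circ> f \<circ> inv_into U \<phi>) holomorphic_on (\<phi> ` (U \<inter> {x \<in> topspace X. f x \<in> V}))"
proof -
  have "\<forall>(V, \<psi>)\<in>B.
      (\<psi> \<circ> f \<circ> inv_into U \<phi>) holomorphic_on (\<phi> ` (U \<inter> {x \<in> topspace X. f x \<in> V}))"
    using assms(1,2) by (auto simp: holomorphic_map_def)
  then show ?thesis using assms(3) by auto
qed

lemma holomorphic_mapI:
  assumes "continuous_map X Y f"
    and "\<And>U \<phi> V \<psi>. (U, \<phi>) \<in> A \<Longrightarrow> (V, \<psi>) \<in> B \<Longrightarrow>
      (\<psi> \<circ> f \<circ> inv_into U \<phi>) holomorphic_on (\<phi> ` (U \<inter> {x \<in> topspace X. f x \<in> V}))"
  shows "holomorphic_map X A Y B f"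
  using assms by (auto simp: holomorphic_map_def)

lemma holomorphic_map_continuous: "holomorphic_map X A Y B f \<Longrightarrow> continuous_map X Y f"
  by (simp add: holomorphic_map_def)

lemma holomorphic_map_funcset:
  "holomorphic_map X A Y B f \<Longrightarrow> x \<in> topspace X \<Longrightarrow> f x \<in> topspace Y"
  unfolding holomorphic_map_def continuous_map_def by blast

lemma holomorphic_map_cong:
  assumes "holomorphic_atlas X A" "holomorphic_map X A Y B f"
    and eq: "\<And>x. x \<in> topspace X \<Longrightarrow> f x = g x"
  shows "holomorphic_map X A Y B g"
proof (rule holomorphic_mapI)
  show "continuous_map X Y g"
    using continuous_map_eq[OF holomorphic_map_continuous[OF assms(2)] eq] .
next
  fix U \<phi> V \<psi> assume UV: "(U, \<phi>) \<in> A" "(V, \<psi>) \<in> B"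
  have U: "U \<subseteq> topspace X"
    using is_chart_subset[OF holomorphic_atlas_chart[OF assms(1) UV(1)]] .
  have "{x \<in> topspace X. f x \<in> V} = {x \<in> topspace X. g x \<in> V}"
    using eq by auto
  then have hol: "(\<psi> \<circ> f \<circ> inv_into U \<phi>) holomorphic_on (\<phi> ` (U \<inter> {x \<in> topspace X. g x \<in> V}))"
    using holomorphic_mapD[OF assms(2) UV] by simp
  then show "(\<psi> \<circ> g \<circ> inv_into U \<phi>) holomorphic_on (\<phi> ` (U \<inter> {x \<in> topspace X. g x \<in> V}))"
  proof (rule holomorphic_transform)
    fix z assume "z \<in> \<phi> ` (U \<inter> {x \<in> topspace X. g x \<in> V})"
    then have "inv_into U \<phi> z \<in> U"
      by (auto intro: inv_into_into)
    then show "(\<psi> \<circ> f \<circ> inv_into U \<phi>) z = (\<psi> \<circ> g \<circ> inv_into U \<phi>) z"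
      using U eq by auto
  qed
qed

text \<open>Differentiability at a point gives differentiability there within any set. A chart
  expression may thus be checked on a small neighbourhood of each point, on which one auxiliary
  chart suffices.\<close>

lemma holomorphic_onI_local:
  assumes "\<And>z. z \<in> S \<Longrightarrow> \<exists>N. open N \<and> z \<in> N \<and> f holomorphic_on N"
  shows "f holomorphic_on S"
  unfolding holomorphic_on_def
proof
  fix z assume "z \<in> S"
  then obtain N where "open N" "z \<in> N" "f holomorphic_on N"
    using assms by blast
  then show "f field_differentiable at z within S"
    using holomorphic_on_imp_differentiable_at field_differentiable_at_within by blast
qed

text \<open>Near each point \<open>x\<close> one chart \<open>(V, \<psi>)\<close> around
  \<open>f x\<close> is inserted; locally the chart expression of the composite factors through
  \<open>\<psi>\<close> into those of \<open>f\<close> and \<open>g\<close>.\<close>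

lemma holomorphic_map_compose:
  assumes X: "holomorphic_atlas X A" and Y: "holomorphic_atlas Y B"
    and Z: "\<And>c. c \<in> C \<Longrightarrow> is_chart Z c"
    and f: "holomorphic_map X A Y B f" and g: "holomorphic_map Y B Z C g"
  shows "holomorphic_map X A Z C (g \<circ> f)"
proof (rule holomorphic_mapI)
  show gf: "continuous_map X Z (g \<circ> f)"
    by (rule continuous_map_compose[OF holomorphic_map_continuous[OF f] holomorphic_map_continuous[OF g]])
  fix U \<phi> W \<theta> assume UW: "(U, \<phi>) \<in> A" "(W, \<theta>) \<in> C"
  have U: "is_chart X (U, \<phi>)" and openU: "openin X U"
    using X UW by (auto simp: holomorphic_atlas_def is_chart_def)
  have openW: "openin Z W"
    using Z[OF UW(2)] by (simp add: is_chart_def)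
  show "(\<theta> \<circ> (g \<circ> f) \<circ> inv_into U \<phi>) holomorphic_on
          \<phi> ` (U \<inter> {x \<in> topspace X. (g \<circ> f) x \<in> W})"
  proof (rule holomorphic_onI_local)
    fix z assume "z \<in> \<phi> ` (U \<inter> {x \<in> topspace X. (g \<circ> f) x \<in> W})"
    then obtain x where x: "x \<in> U" "x \<in> topspace X" "g (f x) \<in> W" "z = \<phi> x" by auto
    obtain V \<psi> where V: "(V, \<psi>) \<in> B" "f x \<in> V"
      using holomorphic_atlas_cover[OF Y holomorphic_map_funcset[OF f x(2)]] by metis
    have openV: "openin Y V" and injV: "inj_on \<psi> V"
      using holomorphic_atlas_chart[OF Y V(1)] is_chart_inj_on by (auto simp: is_chart_def)
    \<comment> \<open>On this open set \<open>f\<close> lands in \<open>V\<close> and the composite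
      lands in \<open>W\<close>, so both chart expressions are defined and can be composed.\<close>
    define N where "N = U \<inter> {x \<in> topspace X. f x \<in> V} \<inter> {x \<in> topspace X. (g \<circ> f) x \<in> W}"
    have "openin X N"
      unfolding N_def
      using openU openV openW gf holomorphic_map_continuous[OF f]
      by (intro openin_Int openin_continuous_map_preimage[where Y=Y]
                openin_continuous_map_preimage[where Y=Z]) (auto simp: o_def)
    then have opN: "open (\<phi> ` N)"
      by (rule is_chart_open_image[OF U]) (auto simp: N_def)
    have "(\<psi> \<circ> f \<circ> inv_into U \<phi>) holomorphic_on \<phi> ` N"
      by (rule holomorphic_on_subset[OF holomorphic_mapD[OF f UW(1) V(1)]]) (auto simp: N_def)
    moreover have "(\<theta> \<circ> g \<circ> inv_into V \<psi>) holomorphic_on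
        (\<psi> ` (V \<inter> {y \<in> topspace Y. g y \<in> W}))"
      by (rule holomorphic_mapD[OF g V(1) UW(2)])
    moreover have inv: "inv_into U \<phi> (\<phi> y) = y" if "y \<in> N" for y
      using is_chart_inj_on[OF U] that by (auto simp: N_def)
    moreover have "f y \<in> topspace Y" if "y \<in> N" for y
      using holomorphic_map_funcset[OF f] that by (auto simp: N_def)
    ultimately have "((\<theta> \<circ> g \<circ> inv_into V \<psi>) \<circ> (\<psi> \<circ> f \<circ> inv_into U \<phi>)) holomorphic_on \<phi> ` N"
      by (elim holomorphic_on_compose_gen) (auto simp: N_def)
    then have "(\<theta> \<circ> (g \<circ> f) \<circ> inv_into U \<phi>) holomorphic_on \<phi> ` N"
    proof (rule holomorphic_transform)
      fix w assume "w \<in> \<phi> ` N"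
      then obtain y where y: "y \<in> N" "w = \<phi> y" by auto
      then have "inv_into V \<psi> (\<psi> (f y)) = f y"
        using injV by (auto simp: N_def)
      then show "((\<theta> \<circ> g \<circ> inv_into V \<psi>) \<circ> (\<psi> \<circ> f \<circ> inv_into U \<phi>)) w
                 = (\<theta> \<circ> (g \<circ> f) \<circ> inv_into U \<phi>) w"
        using y inv by simp
    qed
    moreover have "z \<in> \<phi> ` N"
      using x V by (auto simp: N_def)
    ultimately show "\<exists>N. open N \<and> z \<in> N \<and> (\<theta> \<circ> (g \<circ> f) \<circ> inv_into U \<phi>) holomorphic_on N"
      using opN by blast
  qed
qed

text \<open>In charts the identity becomes a transition function of \<open>A\<close>, holomorphic by
  the atlas condition.\<close>

lemma holomorphic_map_inclusion:
  assumes X: "holomorphic_atlas X A" and "W \<subseteq> W'"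
  shows "holomorphic_map (subtopology X W) (restrict_atlas A W)
           (subtopology X W') (restrict_atlas A W') id"
  unfolding holomorphic_map_def
proof (intro conjI)
  show "continuous_map (subtopology X W) (subtopology X W') id"
    using assms(2) by (auto simp: continuous_map_in_subtopology intro: continuous_map_from_subtopology)
next
  have tr: "(\<psi> \<circ> id \<circ> inv_into (U \<inter> W) \<phi>) holomorphic_on
      (\<phi> ` (U \<inter> W \<inter> {x \<in> topspace (subtopology X W). id x \<in> V \<inter> W'}))"
    if "(U, \<phi>) \<in> A" "(V, \<psi>) \<in> A" for U \<phi> V \<psi>
  proof -
    have inj: "inj_on \<phi> U"
      using is_chart_inj_on[OF holomorphic_atlas_chart[OF X that(1)]] .
    have "(\<psi> \<circ> inv_into U \<phi>) holomorphic_on (\<phi> ` (U \<inter> V))"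
      using X that by (fastforce simp: holomorphic_atlas_def)
    then have "(\<psi> \<circ> inv_into U \<phi>) holomorphic_on
        (\<phi> ` (U \<inter> W \<inter> {x \<in> topspace (subtopology X W). id x \<in> V \<inter> W'}))"
      by (rule holomorphic_on_subset) auto
    then show ?thesis
      by (rule holomorphic_transform) (auto simp: inv_into_subset_eq[OF inj, of "U \<inter> W"])
  qed
  then show "\<forall>(U, \<phi>)\<in>restrict_atlas A W. \<forall>(V, \<psi>)\<in>restrict_atlas A W'.
       (\<psi> \<circ> id \<circ> inv_into U \<phi>) holomorphic_on
         \<phi> ` (U \<inter> {x \<in> topspace (subtopology X W). id x \<in> V})"
    unfolding restrict_atlas_def by blast
qed

text \<open>Continuity and holomorphy are local on the source. This serves to assemble a map on
  \<open>X\<close> from the pieces of an exhaustion, and its inverse from the images of those pieces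
  in the plane.\<close>

lemma holomorphic_map_glue:
  fixes M :: "'i \<Rightarrow> 'a set"
  assumes X: "holomorphic_atlas X A" and Y: "\<And>c. c \<in> B \<Longrightarrow> is_chart Y c"
    and M: "\<And>j. openin X (M j)" "(\<Union>j. M j) = topspace X"
    and f: "\<And>j. holomorphic_map (subtopology X (M j)) (restrict_atlas A (M j)) Y B f"
  shows "holomorphic_map X A Y B f"
proof (rule holomorphic_mapI)
  show cont: "continuous_map X Y f"
  proof (rule pasting_lemma[where I=UNIV and T=M and f="\<lambda>_. f"])
    show "continuous_map (subtopology X (M i)) Y f" for i
      using f holomorphic_map_continuous by blast
  qed (use M in auto)
  fix U \<phi> V \<psi> assume UV: "(U, \<phi>) \<in> A" "(V, \<psi>) \<in> B"
  have U: "is_chart X (U, \<phi>)" and openU: "openin X U" and openV: "openin Y V"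
    using holomorphic_atlas_chart[OF X UV(1)] Y[OF UV(2)] by (auto simp: is_chart_def)
  show "(\<psi> \<circ> f \<circ> inv_into U \<phi>) holomorphic_on \<phi> ` (U \<inter> {x \<in> topspace X. f x \<in> V})"
  proof (rule holomorphic_onI_local)
    fix z assume "z \<in> \<phi> ` (U \<inter> {x \<in> topspace X. f x \<in> V})"
    then obtain x where x: "x \<in> U" "x \<in> topspace X" "f x \<in> V" "z = \<phi> x" by auto
    then obtain j where j: "x \<in> M j" using M by blast
    define N where "N = U \<inter> M j \<inter> {x \<in> topspace (subtopology X (M j)). f x \<in> V}"
    have "N = U \<inter> M j \<inter> {x \<in> topspace X. f x \<in> V}"
      by (auto simp: N_def)
    then have "openin X N"
      using openU openV M cont by (auto intro!: openin_Int openin_continuous_map_preimage)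
    then have opN: "open (\<phi> ` N)"
      by (rule is_chart_open_image[OF U]) (auto simp: N_def)
    have "(U \<inter> M j, \<phi>) \<in> restrict_atlas A (M j)"
      using UV by (auto simp: restrict_atlas_def)
    from holomorphic_mapD[OF f this UV(2)]
    have "(\<psi> \<circ> f \<circ> inv_into (U \<inter> M j) \<phi>) holomorphic_on \<phi> ` N"
      by (simp add: N_def)
    then have "(\<psi> \<circ> f \<circ> inv_into U \<phi>) holomorphic_on \<phi> ` N"
      by (rule holomorphic_transform)
         (auto simp: N_def inv_into_subset_eq[OF is_chart_inj_on[OF U], of "U \<inter> M j"])
    moreover have "z \<in> \<phi> ` N"
      using x j by (auto simp: N_def)
    ultimately show "\<exists>N. open N \<and> z \<in> N \<and> (\<psi> \<circ> f \<circ> inv_into U \<phi>) holomorphic_on N"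
      using opN by blast
  qed
qed

section \<open>Plane domains as surfaces\<close>

lemma inv_into_id: "z \<in> S \<Longrightarrow> inv_into S id z = z"
  by (metis id_apply inj_on_id inv_into_f_f)

lemma holomorphic_atlas_plane:
  assumes "open S"
  shows "holomorphic_atlas (top_of_set S) (plane_atlas S)"
proof -
  have "(id \<circ> inv_into S id) holomorphic_on S"
    by (rule holomorphic_transform[OF holomorphic_on_id]) (simp add: inv_into_id)
  moreover have "homeomorphic_map (top_of_set S) (top_of_set S) id"
    by simp
  ultimately show ?thesis
    using assms
    by (auto simp: holomorphic_atlas_def plane_atlas_def is_chart_def subtopology_subtopology)
qed

text \<open>Both atlases consist of the single chart \<open>id\<close>, so the only chart expression
  agrees with \<open>f\<close> on \<open>S\<close>. This is the passage between maps of surfaces and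
  ordinary complex analysis.\<close>

lemma holomorphic_map_plane_iff:
  assumes "open S"
  shows "holomorphic_map (top_of_set S) (plane_atlas S) (top_of_set S') (plane_atlas S') f
           \<longleftrightarrow> f holomorphic_on S \<and> f ` S \<subseteq> S'"
proof -
  have *: "(id \<circ> f \<circ> inv_into S id) holomorphic_on S \<longleftrightarrow> f holomorphic_on S"
    by (rule holomorphic_cong) (auto simp: inv_into_id)
  have "S \<inter> {x \<in> S. f x \<in> S'} = S" if "f \<in> S \<rightarrow> S'"
    using that by auto
  with * show ?thesis
    by (auto simp: holomorphic_map_def plane_atlas_def continuous_map_in_subtopology
             intro: holomorphic_on_imp_continuous_on)
qed

lemma restrict_plane_atlas: "S \<subseteq> G \<Longrightarrow> restrict_atlas (plane_atlas G) S = plane_atlas S"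
  by (auto simp: restrict_atlas_def plane_atlas_def Int_absorb1)

text \<open>Exchanges one planar model of \<open>X\<close> for another, in particular a simply
  connected domain for the disc.\<close>

lemma biholomorphic_trans_plane:
  assumes X: "holomorphic_atlas X A" and S: "open S" "open S'"
    and "biholomorphic X A (top_of_set S) (plane_atlas S)"
    and h: "h holomorphic_on S" "k holomorphic_on S'"
      "\<And>z. z \<in> S \<Longrightarrow> h z \<in> S' \<and> k (h z) = z" "\<And>z. z \<in> S' \<Longrightarrow> k z \<in> S \<and> h (k z) = z"
  shows "biholomorphic X A (top_of_set S') (plane_atlas S')"
proof -
  note at = X holomorphic_atlas_plane[OF S(1)] holomorphic_atlas_plane[OF S(2)]
  obtain f g where f: "holomorphic_map X A (top_of_set S) (plane_atlas S) f"
    and g: "holomorphic_map (top_of_set S) (plane_atlas S) X A g"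
    and inv: "\<And>x. x \<in> topspace X \<Longrightarrow> g (f x) = x" "\<And>y. y \<in> S \<Longrightarrow> f (g y) = y"
    using assms(4) by (auto simp: biholomorphic_def)
  have "holomorphic_map (top_of_set S) (plane_atlas S) (top_of_set S') (plane_atlas S') h"
       "holomorphic_map (top_of_set S') (plane_atlas S') (top_of_set S) (plane_atlas S) k"
    using h by (auto simp: holomorphic_map_plane_iff S)
  then have "holomorphic_map X A (top_of_set S') (plane_atlas S') (h \<circ> f)"
            "holomorphic_map (top_of_set S') (plane_atlas S') X A (g \<circ> k)"
    using holomorphic_map_compose[OF at(1,2) holomorphic_atlas_chart[OF at(3)] f]
          holomorphic_map_compose[OF at(3,2) holomorphic_atlas_chart[OF at(1)] _ g] by blast+
  moreover have "f x \<in> S" if "x \<in> topspace X" for x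
    using holomorphic_map_funcset[OF f that] by simp
  ultimately show ?thesis
    unfolding biholomorphic_def using inv h by (intro exI[of _ "h \<circ> f"] exI[of _ "g \<circ> k"]) auto
qed

section \<open>Exhaustions by copies of a plane domain and their direct limits\<close>

locale plane_exhaustion =
  fixes X :: "'a topology" and A :: "'a chart set" and \<Omega> :: "complex set"
    and M :: "nat \<Rightarrow> 'a set" and g :: "nat \<Rightarrow> 'a \<Rightarrow> complex" and \<phi> :: "nat \<Rightarrow> complex \<Rightarrow> 'a"
  assumes atlas: "holomorphic_atlas X A" and open_\<Omega>: "open \<Omega>"
    and open_M: "\<And>j. openin X (M j)" and M_Suc: "\<And>j. M j \<subseteq> M (Suc j)"
    and M_cover: "(\<Union>j. M j) = topspace X"
    and g: "\<And>j. holomorphic_map (subtopology X (M j)) (restrict_atlas A (M j))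
                   (top_of_set \<Omega>) (plane_atlas \<Omega>) (g j)"
    and \<phi>: "\<And>j. holomorphic_map (top_of_set \<Omega>) (plane_atlas \<Omega>)
                   (subtopology X (M j)) (restrict_atlas A (M j)) (\<phi> j)"
    and \<phi>_g: "\<And>j x. x \<in> M j \<Longrightarrow> \<phi> j (g j x) = x"
    and g_\<phi>: "\<And>j z. z \<in> \<Omega> \<Longrightarrow> g j (\<phi> j z) = z"
begin

text \<open>This is the inclusion of \<open>M k\<close> into \<open>M (Suc k)\<close>, read in the
  coordinates \<open>g k\<close> and \<open>g (Suc k)\<close>.\<close>

definition transition :: "nat \<Rightarrow> complex \<Rightarrow> complex" where
  "transition k = g (Suc k) \<circ> \<phi> k"

lemma topspace_M: "topspace (subtopology X (M j)) = M j"
  using openin_subset[OF open_M, of j] by auto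

lemma \<phi>_in: "z \<in> \<Omega> \<Longrightarrow> \<phi> j z \<in> M j"
  using holomorphic_map_funcset[OF \<phi>, of z j] by (simp only: topspace_M topspace_euclidean_subtopology)

lemma g_in: "x \<in> M j \<Longrightarrow> g j x \<in> \<Omega>"
  using holomorphic_map_funcset[OF g, of x j] by (simp only: topspace_M topspace_euclidean_subtopology)

lemma M_mono: "i \<le> j \<Longrightarrow> M i \<subseteq> M j"
  using lift_Suc_mono_le[of M] M_Suc by blast

lemmas atlas_M = holomorphic_atlas_restrict[OF atlas open_M]

lemma plane_charts: "open S \<Longrightarrow> c \<in> plane_atlas S \<Longrightarrow> is_chart (top_of_set S) c"
  using holomorphic_atlas_chart holomorphic_atlas_plane by blast

lemma transition_holomorphic: "transition k holomorphic_on \<Omega>"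
  and transition_in: "transition k ` \<Omega> \<subseteq> \<Omega>"
proof -
  have "holomorphic_map (top_of_set \<Omega>) (plane_atlas \<Omega>)
          (subtopology X (M (Suc k))) (restrict_atlas A (M (Suc k))) (id \<circ> \<phi> k)" for k
    by (rule holomorphic_map_compose[OF holomorphic_atlas_plane[OF open_\<Omega>] atlas_M
          holomorphic_atlas_chart[OF atlas_M] \<phi> holomorphic_map_inclusion[OF atlas M_Suc]])
  from holomorphic_map_compose[OF holomorphic_atlas_plane[OF open_\<Omega>] atlas_M
          plane_charts[OF open_\<Omega>] this g]
  have "holomorphic_map (top_of_set \<Omega>) (plane_atlas \<Omega>) (top_of_set \<Omega>) (plane_atlas \<Omega>)
          (transition k)"
    by (simp add: transition_def)
  then show "transition k holomorphic_on \<Omega>" "transition k ` \<Omega> \<subseteq> \<Omega>"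
    by (auto simp: holomorphic_map_plane_iff open_\<Omega>)
qed

lemma \<phi>_transition: "z \<in> \<Omega> \<Longrightarrow> \<phi> (Suc k) (transition k z) = \<phi> k z"
  using \<phi>_in M_Suc by (auto simp: transition_def intro!: \<phi>_g)

lemma transition_g: "x \<in> M k \<Longrightarrow> transition k (g k x) = g (Suc k) x"
  by (simp add: transition_def \<phi>_g)

lemma transition_inj: "inj_on (transition k) \<Omega>"
  by (metis \<phi>_transition g_\<phi> inj_onI)

text \<open>A point of \<open>M (Suc k)\<close> whose coordinate is hit by the transition map comes
  from \<open>M k\<close>, since that map is an inclusion in disguise.\<close>

lemma M_Suc_eq: "transition k ` \<Omega> = \<Omega> \<Longrightarrow> M (Suc k) = M k"
proof -
  assume surj: "transition k ` \<Omega> = \<Omega>"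
  have "x \<in> M k" if "x \<in> M (Suc k)" for x
  proof -
    have "g (Suc k) x \<in> transition k ` \<Omega>"
      using g_in[OF that] surj by simp
    then obtain z where z: "z \<in> \<Omega>" "g (Suc k) x = transition k z"
      by blast
    then have "x = \<phi> k z"
      using \<phi>_transition[OF z(1)] \<phi>_g[OF that] by simp
    then show ?thesis using \<phi>_in z by simp
  qed
  then show ?thesis using M_Suc by blast
qed

text \<open>Onto transitions make the exhaustion constant from \<open>J\<close> on, so
  \<open>M J\<close> is all of \<open>X\<close> and \<open>g J\<close> is the required map.\<close>

lemma biholomorphic_stable:
  assumes "\<And>k. k \<ge> J \<Longrightarrow> transition k ` \<Omega> = \<Omega>"
  shows "biholomorphic X A (top_of_set \<Omega>) (plane_atlas \<Omega>)"
proof -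
  have "M k = M J" if "k \<ge> J" for k
    using that by (induction rule: dec_induct) (use M_Suc_eq assms in auto)
  then have "M k \<subseteq> M J" for k
    by (metis M_mono nle_le)
  then have "M J = topspace X"
    using M_cover by blast
  then show ?thesis
    using g[of J] \<phi>[of J] \<phi>_g[of _ J] g_\<phi>[of _ J]
    unfolding biholomorphic_def
    by (intro exI[of _ "g J"] exI[of _ "\<phi> J"]) (auto simp: restrict_atlas_topspace[OF atlas])
qed

text \<open>The compatibility \<open>H\<close> says that \<open>H k \<circ> g k\<close> and
  \<open>H (Suc k) \<circ> g (Suc k)\<close> agree on \<open>M k\<close>. These functions therefore
  glue to one injective map \<open>h\<close> of \<open>X\<close> onto the union of the images, with
  a holomorphic inverse on each image.\<close>

lemma biholomorphic_direct_limit: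
  assumes hol: "\<And>k. H k holomorphic_on \<Omega>" and inj: "\<And>k. inj_on (H k) \<Omega>"
    and H: "\<And>k z. z \<in> \<Omega> \<Longrightarrow> H (Suc k) (transition k z) = H k z"
  shows "biholomorphic X A (top_of_set (\<Union>k. H k ` \<Omega>)) (plane_atlas (\<Union>k. H k ` \<Omega>))"
proof -
  define G where "G = (\<Union>k. H k ` \<Omega>)"
  \<comment> \<open>\<open>LEAST\<close> merely selects some stage containing \<open>x\<close>;
    compatibility will show that any other stage gives the same value.\<close>
  define h where "h x = H (LEAST k. x \<in> M k) (g (LEAST k. x \<in> M k) x)" for x
  have openH: "open (H k ` \<Omega>)" for k
    using open_mapping_thm3 hol inj open_\<Omega> by blast
  then have openG: "open G" by (auto simp: G_def)
  have "H k (g k x) = H i (g i x)" if "i \<le> k" "x \<in> M i" for i k x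
    using that
  proof (induction rule: dec_induct)
    case (step n)
    then have "x \<in> M n" using M_mono by blast
    with step show ?case
      using H[OF g_in, of x n n] transition_g by simp
  qed auto
  then have h: "h x = H k (g k x)" if "x \<in> M k" for x k
    using that unfolding h_def by (metis LeastI Least_le)
  have hol_h: "holomorphic_map X A (top_of_set G) (plane_atlas G) h"
  proof (rule holomorphic_map_glue[OF atlas plane_charts[OF openG] open_M M_cover])
    fix j
    have "holomorphic_map (top_of_set \<Omega>) (plane_atlas \<Omega>) (top_of_set G) (plane_atlas G) (H j)"
      using hol by (auto simp: holomorphic_map_plane_iff open_\<Omega> G_def)
    from holomorphic_map_compose[OF atlas_M holomorphic_atlas_plane[OF open_\<Omega>]
        plane_charts[OF openG] g this]
    show "holomorphic_map (subtopology X (M j)) (restrict_atlas A (M j)) (top_of_set G) (plane_atlas G) h"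
      by (rule holomorphic_map_cong[OF atlas_M]) (use h[of _ j] in \<open>auto simp: topspace_M\<close>)
  qed
  have \<phi>_top: "\<phi> k z \<in> topspace X" if "z \<in> \<Omega>" for k z
    using \<phi>_in[OF that] M_cover by blast
  define f where "f y = (let k = (LEAST k. y \<in> H k ` \<Omega>) in \<phi> k (inv_into \<Omega> (H k) y))" for y
  have hH: "h (\<phi> k z) = H k z" if "z \<in> \<Omega>" for k z
    using h[OF \<phi>_in[OF that]] g_\<phi>[OF that] by simp
  \<comment> \<open>Two points always lie in a common stage, and there both \<open>g\<close> and
    \<open>H\<close> are injective.\<close>
  have inj_h: "x = y" if "x \<in> topspace X" "y \<in> topspace X" "h x = h y" for x y
  proof -
    obtain i j where "x \<in> M i" "y \<in> M j" using \<open>x \<in> _\<close> \<open>y \<in> _\<close> M_cover by blast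
    then have "x \<in> M (max i j)" "y \<in> M (max i j)"
      using M_mono[of i "max i j"] M_mono[of j "max i j"] by auto
    then show ?thesis
      using that(3) h inj[of "max i j"] g_in \<phi>_g by (metis inj_onD)
  qed
  have fh: "f y \<in> topspace X \<and> h (f y) = y" if "y \<in> G" for y
  proof -
    define k where "k = (LEAST k. y \<in> H k ` \<Omega>)"
    have y: "y \<in> H k ` \<Omega>" using that unfolding G_def k_def by (auto intro: LeastI)
    then have "inv_into \<Omega> (H k) y \<in> \<Omega>" "H k (inv_into \<Omega> (H k) y) = y"
      by (auto intro: inv_into_into f_inv_into_f)
    moreover have "f y = \<phi> k (inv_into \<Omega> (H k) y)"
      by (simp add: f_def k_def Let_def)
    ultimately show ?thesis
      using hH \<phi>_top by auto
  qed
  \<comment> \<open>The choice of stage in \<open>f\<close> is immaterial: all candidates have the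
    same image under the injective map \<open>h\<close>.\<close>
  have f: "f y = \<phi> k (inv_into \<Omega> (H k) y)" if "y \<in> H k ` \<Omega>" for k y
  proof (rule inj_h)
    have "inv_into \<Omega> (H k) y \<in> \<Omega>" "H k (inv_into \<Omega> (H k) y) = y"
      using that by (auto intro: inv_into_into f_inv_into_f)
    then show "\<phi> k (inv_into \<Omega> (H k) y) \<in> topspace X" "h (f y) = h (\<phi> k (inv_into \<Omega> (H k) y))"
      using \<phi>_top hH fh[of y] that by (auto simp: G_def)
    show "f y \<in> topspace X" using fh that by (auto simp: G_def)
  qed
  have hol_f: "holomorphic_map (top_of_set G) (plane_atlas G) X A f"
  proof (rule holomorphic_map_glue[OF holomorphic_atlas_plane[OF openG] holomorphic_atlas_chart[OF atlas]])
    show "openin (top_of_set G) (H k ` \<Omega>)" for k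
      using openH by (auto intro!: open_subset simp: G_def)
    show "(\<Union>k. H k ` \<Omega>) = topspace (top_of_set G)" by (simp add: G_def)
    fix k
    obtain H' where H': "H' holomorphic_on H k ` \<Omega>" "\<And>z. z \<in> \<Omega> \<Longrightarrow> H' (H k z) = z"
      using holomorphic_has_inverse[OF hol open_\<Omega> inj, of k] by metis
    have "holomorphic_map (top_of_set (H k ` \<Omega>)) (plane_atlas (H k ` \<Omega>))
            (top_of_set \<Omega>) (plane_atlas \<Omega>) H'"
      using H' by (auto simp: holomorphic_map_plane_iff openH)
    note comp1 = holomorphic_map_compose[OF holomorphic_atlas_plane[OF openH]
        holomorphic_atlas_plane[OF open_\<Omega>] holomorphic_atlas_chart[OF atlas_M] this \<phi>, of k]
    have "holomorphic_map (subtopology X (M k)) (restrict_atlas A (M k)) X A id"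
      using holomorphic_map_inclusion[OF atlas, of "M k" "topspace X"] M_cover
      by (auto simp: restrict_atlas_topspace[OF atlas])
    from holomorphic_map_compose[OF holomorphic_atlas_plane[OF openH] atlas_M
        holomorphic_atlas_chart[OF atlas] comp1 this]
    have "holomorphic_map (top_of_set (H k ` \<Omega>)) (plane_atlas (H k ` \<Omega>)) X A f"
    proof (rule holomorphic_map_cong[OF holomorphic_atlas_plane[OF openH]])
      fix y assume "y \<in> topspace (top_of_set (H k ` \<Omega>))"
      then show "(id \<circ> (\<phi> k \<circ> H')) y = f y"
        using f[of y k] H'(2) inj[of k] by auto
    qed
    moreover have "H k ` \<Omega> \<subseteq> G" by (auto simp: G_def)
    ultimately show "holomorphic_map (subtopology (top_of_set G) (H k ` \<Omega>))
       (restrict_atlas (plane_atlas G) (H k ` \<Omega>)) X A f"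
      by (simp add: restrict_plane_atlas subtopology_subtopology Int_absorb1)
  qed
  have "f (h x) = x" if "x \<in> topspace X" for x
    using inj_h[of "f (h x)" x] fh[of "h x"] that holomorphic_map_funcset[OF hol_h that] by auto
  then show ?thesis
    unfolding biholomorphic_def G_def[symmetric] using hol_h hol_f fh by auto
qed

end

section \<open>Univalent self-maps of finitely punctured planes\<close>

text \<open>Punctures, including the one at infinity, are encoded as filters so that they can be
  handled and counted uniformly. Great Picard excludes essential singularities of an injective
  function, leaving a finite limit or a pole.\<close>

lemma univalent_finite_puncture_limits:
  fixes f :: "complex \<Rightarrow> complex"
  assumes S: "finite S" and f: "f holomorphic_on - S" "inj_on f (- S)"
    and F: "F \<in> insert at_infinity (at ` S)"
  shows "(\<exists>l. (f \<longlongrightarrow> l) F) \<or> filterlim f at_infinity F"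
proof -
  have inf: "infinite (- S)"
    using S by (simp add: infinite_UNIV_char_0)
  text \<open>An injective function omits near an isolated singularity the values it takes elsewhere.\<close>
  have *: "(\<exists>l. (h \<longlongrightarrow> l) (at p)) \<or> filterlim h at_infinity (at p)"
    if N: "open N" "p \<in> N" "h holomorphic_on N - {p}" "inj_on h (N - {p})"
      and ab: "a \<noteq> b" "a \<notin> h ` (N - {p})" "b \<notin> h ` (N - {p})" for h p N a b
  proof -
    obtain l where "(h \<longlongrightarrow> l) (at p) \<or> ((inverse \<circ> h) \<longlongrightarrow> l) (at p)"
      using great_Picard[OF N(1,2) ab(1) N(3)] ab by (metis image_eqI)
    \<comment> \<open>Since \<open>inverse 0 = 0\<close>, the limit \<open>0\<close> of
      \<open>inverse \<circ> h\<close> means a pole only once \<open>h\<close> has no zeros near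
      \<open>p\<close>. Injectivity leaves at most one zero, which a smaller neighbourhood
      avoids.\<close>
    moreover have "filterlim h at_infinity (at p)" if "((inverse \<circ> h) \<longlongrightarrow> 0) (at p)"
    proof -
      have "\<forall>\<^sub>F z in at p. h z \<noteq> 0"
      proof (cases "\<exists>q\<in>N - {p}. h q = 0")
        case True
        then obtain q where q: "q \<in> N - {p}" "h q = 0" by blast
        have "\<forall>\<^sub>F z in at p. z \<in> N - {q} - {p}"
          using N q by (auto simp: eventually_at_topological intro!: exI[of _ "N - {q}"])
        then show ?thesis
          by eventually_elim (use q N(4) in \<open>force dest: inj_onD[of h _ _ q]\<close>)
      next
        case False
        have "\<forall>\<^sub>F z in at p. z \<in> N - {p}"
          using N by (auto simp: eventually_at_topological)
        then show ?thesis
          by eventually_elim (use False in auto)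
      qed
      then have "\<forall>\<^sub>F z in at p. inverse (h z) \<noteq> 0"
        by eventually_elim auto
      with that show ?thesis
        by (auto simp: filterlim_inverse_at_iff[symmetric] filterlim_at o_def)
    qed
    moreover have "(h \<longlongrightarrow> inverse l) (at p)" if "((inverse \<circ> h) \<longlongrightarrow> l) (at p)" "l \<noteq> 0"
      using tendsto_inverse[OF that] by (simp add: o_def)
    ultimately show ?thesis by metis
  qed
  show ?thesis
  proof (cases "F = at_infinity")
    case False
    then obtain p where p: "p \<in> S" "F = at p" using F by auto
    obtain A where A: "A \<subseteq> - S" "finite A" "card A = 2"
      using infinite_arbitrarily_large[OF inf] by metis
    then obtain a b where ab: "A = {a, b}" "a \<noteq> b" by (auto simp: card_2_iff)
    \<comment> \<open>Removing \<open>a\<close> and \<open>b\<close> from the neighbourhood makes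
      \<open>f a\<close> and \<open>f b\<close> two omitted values, as \<open>f\<close> is
      injective.\<close>
    define N where "N = - ((S - {p}) \<union> {a, b})"
    have sub: "N - {p} \<subseteq> - S" by (auto simp: N_def)
    have "f a \<notin> f ` (N - {p})" "f b \<notin> f ` (N - {p})"
      using sub A ab f(2) by (auto simp: N_def dest!: inj_onD)
    then show ?thesis unfolding p(2)
    proof (rule *[rotated 5])
      show "open N" unfolding N_def using S by (intro open_Compl finite_imp_closed) auto
      show "p \<in> N" using p A ab by (auto simp: N_def)
      show "f holomorphic_on N - {p}" "inj_on f (N - {p})"
        using f sub holomorphic_on_subset inj_on_subset by blast+
      show "f a \<noteq> f b" using f(2) A ab by (auto dest: inj_onD)
    qed
  next
    case True
    \<comment> \<open>The puncture at infinity is moved to \<open>0\<close> by inversion. Taking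
      \<open>a\<close> and \<open>b\<close> nonzero keeps \<open>0\<close> inside \<open>N\<close>,
      from which their inverses are removed.\<close>
    obtain A where A: "A \<subseteq> - insert 0 S" "finite A" "card A = 2"
      using infinite_arbitrarily_large[of "- insert 0 S"] S infinite_UNIV_char_0
      by (metis finite_insert finite_compl)
    then obtain a b where ab: "A = {a, b}" "a \<noteq> b" by (auto simp: card_2_iff)
    define N where "N = - (inverse ` (S - {0} \<union> {a, b}))"
    define h where "h = f \<circ> inverse"
    have sub: "inverse w \<in> - S - {a, b}" if "w \<in> N - {0}" for w
      using that by (auto simp: N_def image_iff dest: bspec[of _ _ "inverse w"])
    have "(\<exists>l. (h \<longlongrightarrow> l) (at 0)) \<or> filterlim h at_infinity (at 0)"
    proof (rule *)
      show "open N" unfolding N_def using S by (intro open_Compl finite_imp_closed) auto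
      show "0 \<in> N" using A ab by (auto simp: N_def image_iff)
      show "h holomorphic_on N - {0}"
        unfolding h_def using sub
        by (intro holomorphic_on_compose_gen[OF _ f(1)] holomorphic_intros) auto
      show "inj_on h (N - {0})"
        unfolding h_def using sub
        by (intro comp_inj_on inj_on_subset[OF f(2)]) (auto simp: inj_on_def)
      show "f a \<noteq> f b" using f(2) A ab by (auto dest: inj_onD)
      show "f a \<notin> h ` (N - {0})" "f b \<notin> h ` (N - {0})"
        using sub A ab f(2) by (auto simp: h_def dest!: inj_onD)
    qed
    then show ?thesis
    proof
      assume "\<exists>l. (h \<longlongrightarrow> l) (at 0)"
      then obtain l where "(h \<longlongrightarrow> l) (at 0)" ..
      then have "((\<lambda>z. h (inverse z)) \<longlongrightarrow> l) at_infinity"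
        by (rule filterlim_compose) (auto simp: filterlim_at tendsto_inverse_0 eventually_at_infinity intro!: exI[of _ 1])
      then show ?thesis unfolding True h_def by auto
    next
      assume "filterlim h at_infinity (at 0)"
      then have "filterlim (\<lambda>z. h (inverse z)) at_infinity at_infinity"
        by (rule filterlim_compose) (auto simp: filterlim_at tendsto_inverse_0 eventually_at_infinity intro!: exI[of _ 1])
      then show ?thesis unfolding True h_def by auto
    qed
  qed
qed

text \<open>Off a large disc minus small neighbourhoods of the punctures, every remaining point is
  close to some puncture; that difference is the compact set.\<close>

lemma compact_exhausts_finite_complement:
  fixes S :: "complex set"
  assumes S: "finite S" and P: "\<And>F. F \<in> insert at_infinity (at ` S) \<Longrightarrow> eventually P F"
  obtains K where "compact K" "K \<subseteq> - S" "\<And>z. z \<in> - S - K \<Longrightarrow> P z"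
proof -
  have "\<exists>N. open N \<and> p \<in> N \<and> (\<forall>z\<in>N - {p}. P z)" if "p \<in> S" for p
    using P[of "at p"] that by (auto simp: eventually_at_topological)
  then obtain N where N: "\<And>p. p \<in> S \<Longrightarrow> open (N p) \<and> p \<in> N p \<and> (\<forall>z\<in>N p - {p}. P z)"
    by metis
  obtain R where R: "\<And>z. R \<le> norm z \<Longrightarrow> P z"
    using P[of at_infinity] by (auto simp: eventually_at_infinity)
  define K where "K = cball 0 R - (\<Union>p\<in>S. N p)"
  show ?thesis
  proof
    show "compact K" unfolding K_def using N by (intro compact_diff) auto
    show "K \<subseteq> - S" using N by (auto simp: K_def)
    show "P z" if "z \<in> - S - K" for z
      using that N R[of z] by (cases "norm z \<ge> R") (auto simp: K_def)
  qed
qed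

text \<open>A count of punctures. Let \<open>L\<close> be the set of finite limits of
  \<open>f\<close> at the punctures, infinity included. The image can have boundary only in
  \<open>L\<close>, so it contains \<open>- L\<close> and is unbounded; hence some puncture is a
  pole and \<open>L\<close> has at most \<open>card S\<close> elements. Since the image avoids
  \<open>S\<close>, also \<open>S \<subseteq> L\<close>, so the two sets coincide.\<close>

lemma univalent_finite_complement_surj:
  fixes f :: "complex \<Rightarrow> complex"
  assumes S: "finite S" and f: "f holomorphic_on - S" "inj_on f (- S)" and im: "f ` (- S) \<subseteq> - S"
  shows "f ` (- S) = - S"
proof -
  define I where "I = insert at_infinity (at ` S)"
  define J where "J = {F \<in> I. \<exists>l. (f \<longlongrightarrow> l) F}"
  define L where "L = (\<lambda>F. Lim F f) ` J"
  have finI: "finite I" using S by (simp add: I_def)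
  then have finL: "finite L" by (simp add: L_def J_def)
  have ntriv: "F \<noteq> bot" if "F \<in> I" for F
    using that trivial_limit_at_infinity trivial_limit_at unfolding I_def by (metis imageE insertE)
  have lim: "(f \<longlongrightarrow> Lim F f) F" "Lim F f \<in> L" if "F \<in> J" for F
    using that ntriv tendsto_Lim by (fastforce simp: J_def L_def)+
  have pole: "filterlim f at_infinity F" if "F \<in> I - J" for F
    using univalent_finite_puncture_limits[OF S f, of F] that by (auto simp: I_def J_def)
  have open_im: "open (f ` (- S))"
    using open_mapping_thm3[OF f(1) _ f(2)] S by (simp add: finite_imp_closed open_Compl)
  have cont: "continuous_on (- S) f"
    using f holomorphic_on_imp_continuous_on by blast
  \<comment> \<open>A neighbourhood of \<open>y\<close> is avoided by \<open>f\<close> near every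
    puncture; the rest of the domain is covered by a compact \<open>K\<close>, whose image is closed
    and misses \<open>y\<close>.\<close>
  have cl: "\<exists>V. open V \<and> y \<in> V \<and> V \<inter> f ` (- S) = {}" if y: "y \<notin> f ` (- S)" "y \<notin> L" for y
  proof -
    have "\<exists>V. open V \<and> y \<in> V \<and> (\<forall>\<^sub>F z in F. f z \<notin> V)" if "F \<in> I" for F
    proof (cases "F \<in> J")
      case True
      then have "Lim F f \<noteq> y" using lim y by metis
      then obtain U V where "open U" "open V" "Lim F f \<in> U" "y \<in> V" "U \<inter> V = {}"
        using hausdorff by metis
      moreover have "\<forall>\<^sub>F z in F. f z \<in> U"
        using lim(1)[OF True] \<open>open U\<close> \<open>Lim F f \<in> U\<close> topological_tendstoD by blast
      then have "\<forall>\<^sub>F z in F. f z \<notin> V"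
        by eventually_elim (use \<open>U \<inter> V = {}\<close> in auto)
      ultimately show ?thesis by blast
    next
      case False
      have "\<forall>\<^sub>F w::complex in at_infinity. w \<notin> ball 0 (norm y + 1)"
        by (auto simp: eventually_at_infinity intro!: exI[of _ "norm y + 1"])
      then have "\<forall>\<^sub>F z in F. f z \<notin> ball 0 (norm y + 1)"
        using pole[of F] False \<open>F \<in> I\<close> by (auto simp: filterlim_iff)
      then show ?thesis
        by (intro exI[of _ "ball 0 (norm y + 1)"]) auto
    qed
    then obtain V where V: "\<And>F. F \<in> I \<Longrightarrow> open (V F) \<and> y \<in> V F \<and> (\<forall>\<^sub>F z in F. f z \<notin> V F)"
      by metis
    obtain K where K: "compact K" "K \<subseteq> - S" "\<And>z. z \<in> - S - K \<Longrightarrow> f z \<notin> (\<Inter>F\<in>I. V F)"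
    proof (rule compact_exhausts_finite_complement[OF S, of "\<lambda>z. f z \<notin> (\<Inter>F\<in>I. V F)"])
      fix F assume "F \<in> insert at_infinity (at ` S)"
      then have "F \<in> I" by (simp add: I_def)
      then have "\<forall>\<^sub>F z in F. f z \<notin> V F" using V by blast
      then show "\<forall>\<^sub>F z in F. f z \<notin> (\<Inter>F\<in>I. V F)"
        by eventually_elim (use \<open>F \<in> I\<close> in auto)
    qed auto
    have "compact (f ` K)"
      using K cont compact_continuous_image continuous_on_subset by blast
    then have "open ((\<Inter>F\<in>I. V F) - f ` K)"
      using V finI by (intro open_Diff open_INT compact_imp_closed) auto
    moreover have "y \<in> (\<Inter>F\<in>I. V F) - f ` K"
      using V y K by auto
    moreover have "((\<Inter>F\<in>I. V F) - f ` K) \<inter> f ` (- S) = {}"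
      using K by blast
    ultimately show ?thesis by blast
  qed
  have "infinite (f ` (- S))"
    using S f(2) by (simp add: finite_image_iff infinite_UNIV_char_0)
  then have ne: "f ` (- S) - L \<noteq> {}"
    by (metis Diff_eq_empty_iff finite_subset finL)
  \<comment> \<open>A connected set stays connected after removing finitely many points from the
    plane, and in \<open>- L\<close> the image is nonempty, open and closed.\<close>
  have big: "- L \<subseteq> f ` (- S)"
  proof -
    have "connected (- L)"
      using connected_open_delete_finite[of UNIV L] finL by (simp add: Compl_eq_Diff_UNIV connected_UNIV)
    moreover have "openin (top_of_set (- L)) (f ` (- S) - L)"
      using open_im finL by (auto intro!: open_subset open_Diff finite_imp_closed)
    moreover have "open (- (f ` (- S)) - L)"
    proof (subst open_subopen, intro ballI)
      fix y assume y: "y \<in> - (f ` (- S)) - L"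
      then obtain V where V: "open V" "y \<in> V" "V \<inter> f ` (- S) = {}" using cl by blast
      then show "\<exists>T. open T \<and> y \<in> T \<and> T \<subseteq> - (f ` (- S)) - L"
        using y finL by (intro exI[of _ "V - L"]) (auto intro!: open_Diff finite_imp_closed)
    qed
    then have "closedin (top_of_set (- L)) (f ` (- S) - L)"
      by (auto simp: closedin_def openin_open intro!: exI[of _ "- f ` (- S) - L"])
    ultimately have "f ` (- S) - L = - L"
      using ne by (auto simp: connected_clopen)
    then show ?thesis by blast
  qed
  \<comment> \<open>With finite limits at all punctures \<open>f\<close> would be bounded, while its
    image contains a cofinite set. The resulting pole is what lowers the count from
    \<open>card S + 1\<close> to \<open>card S\<close>.\<close>
  have "\<exists>F\<in>I. F \<notin> J"
  proof (rule ccontr)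
    assume nex: "\<not> (\<exists>F\<in>I. F \<notin> J)"
    define P where "P z \<longleftrightarrow> (\<exists>F\<in>I. norm (f z) < norm (Lim F f) + 1)" for z
    obtain K where K: "compact K" "K \<subseteq> - S" "\<And>z. z \<in> - S - K \<Longrightarrow> P z"
    proof (rule compact_exhausts_finite_complement[OF S, of P])
      fix F assume "F \<in> insert at_infinity (at ` S)"
      then have F: "F \<in> I" "F \<in> J" using nex by (auto simp: I_def)
      then have "\<forall>\<^sub>F z in F. norm (f z) < norm (Lim F f) + 1"
        using order_tendstoD(2)[OF tendsto_norm[OF lim(1)], of F] by simp
      then show "eventually P F"
        by eventually_elim (use F in \<open>auto simp: P_def\<close>)
    qed auto
    have "bounded (f ` K)"
      using K cont compact_continuous_image continuous_on_subset compact_imp_bounded by metis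
    moreover have "f ` (- S) \<subseteq> f ` K \<union> (\<Union>F\<in>I. cball 0 (norm (Lim F f) + 1))"
      using K(3) by (force simp: P_def)
    ultimately have "bounded (f ` (- S))"
      using finI by (meson bounded_subset bounded_Un bounded_UN bounded_cball)
    then have "bounded (- L)" using big bounded_subset by blast
    then have "bounded (UNIV :: complex set)"
      by (metis Compl_partition2 bounded_Un finL finite_imp_bounded)
    then show False by simp
  qed
  then obtain F0 where F0: "F0 \<in> I" "F0 \<notin> J" by blast
  have "card L \<le> card J" unfolding L_def by (rule card_image_le) (use finI in \<open>auto simp: J_def\<close>)
  also have "\<dots> \<le> card (I - {F0})"
    using F0 finI by (intro card_mono) (auto simp: J_def)
  also have "\<dots> = card I - 1" using F0 finI by simp
  also have "card I \<le> Suc (card (at ` S))"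
    unfolding I_def using S by (simp add: card_insert_if)
  then have "card I - 1 \<le> card (at ` S)" by simp
  also have "\<dots> \<le> card S" using S by (rule card_image_le)
  finally have "card L \<le> card S" .
  moreover have "S \<subseteq> L" using im big by blast
  ultimately have "S = L" using finL by (metis card_seteq)
  then show ?thesis using im big by blast
qed

section \<open>Self-maps of annuli\<close>

text \<open>The difference is continuous with values in the discrete set of multiples of
  \<open>2 * pi * \<i>\<close>, hence constant on a connected set. This replaces covering space
  theory in the degree arguments below.\<close>

lemma exp_eq_imp_diff_constant:
  fixes p q :: "'a::topological_space \<Rightarrow> complex"
  assumes "connected S" "continuous_on S p" "continuous_on S q"
    and eq: "\<And>x. x \<in> S \<Longrightarrow> exp (p x) = exp (q x)"
  obtains n :: int where "\<And>x. x \<in> S \<Longrightarrow> p x = q x + 2 * of_real pi * of_int n * \<i>"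
proof -
  have ex: "\<exists>n::int. p x - q x = 2 * of_real pi * of_int n * \<i>" if x: "x \<in> S" for x
  proof -
    obtain n :: int where "p x = q x + of_int (2 * n) * pi * \<i>"
      using eq[OF x] unfolding exp_eq by blast
    then show ?thesis by (intro exI[of _ n]) (simp add: algebra_simps)
  qed
  have "(\<lambda>x. p x - q x) constant_on S"
  proof (rule continuous_discrete_range_constant[OF assms(1)])
    show "continuous_on S (\<lambda>x. p x - q x)"
      by (intro continuous_intros assms)
    fix x assume x: "x \<in> S"
    obtain m :: int where m: "p x - q x = 2 * of_real pi * of_int m * \<i>" using ex[OF x] by blast
    have "2 * pi \<le> norm ((p y - q y) - (p x - q x))" if y: "y \<in> S" "p y - q y \<noteq> p x - q x" for y
    proof -
      obtain n :: int where n: "p y - q y = 2 * of_real pi * of_int n * \<i>" using ex[OF y(1)] by blast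
      have "n \<noteq> m" using m n y(2) by auto
      have "(p y - q y) - (p x - q x) = complex_of_real (2 * pi * (of_int (n - m))) * \<i>"
        unfolding m n by (simp add: algebra_simps)
      then have "norm ((p y - q y) - (p x - q x)) = 2 * pi * \<bar>of_int (n - m)\<bar>"
        by (simp add: norm_mult abs_mult del: of_int_diff of_real_mult)
      moreover have "1 \<le> \<bar>of_int (n - m) :: real\<bar>" using \<open>n \<noteq> m\<close> by linarith
      ultimately show ?thesis using pi_gt_zero by auto
    qed
    then show "\<exists>e>0. \<forall>y. y \<in> S \<and> p y - q y \<noteq> p x - q x \<longrightarrow> e \<le> norm ((p y - q y) - (p x - q x))"
      by (intro exI[of _ "2 * pi"]) auto
  qed
  then obtain c where c: "\<And>x. x \<in> S \<Longrightarrow> p x - q x = c"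
    by (auto simp: constant_on_def)
  show ?thesis
  proof (cases "S = {}")
    case False
    then obtain x where x: "x \<in> S" by blast
    then obtain n :: int where "p x - q x = 2 * of_real pi * of_int n * \<i>" using ex by blast
    then show ?thesis using c x that[of n] by (metis add.commute diff_add_cancel)
  qed (use that in auto)
qed

text \<open>The annulus is the image of a convex vertical strip under \<open>exp\<close>.\<close>

lemma connected_annulus:
  fixes r :: real assumes "0 < r"
  shows "connected {z::complex. r < norm z \<and> norm z < 1}"
  and open_annulus: "open {z::complex. r < norm z \<and> norm z < 1}"
proof -
  have "{z::complex. r < norm z \<and> norm z < 1} = exp ` {s. ln r < Re s \<and> Re s < 0}"
  proof (intro equalityI subsetI)
    fix z :: complex assume "z \<in> {z. r < norm z \<and> norm z < 1}"
    then have "z \<noteq> 0" "r < norm z" "norm z < 1" using assms by auto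
    then show "z \<in> exp ` {s. ln r < Re s \<and> Re s < 0}"
      using assms by (intro image_eqI[of _ _ "Ln z"]) auto
  next
    fix z assume "z \<in> exp ` {s. ln r < Re s \<and> Re s < 0}"
    then obtain s where "z = exp s" "ln r < Re s" "Re s < 0" by auto
    then show "z \<in> {z. r < norm z \<and> norm z < 1}"
      using assms exp_less_mono[of "ln r" "Re s"] by auto
  qed
  moreover have "convex {s. ln r < Re s \<and> Re s < 0}"
    using convex_Int[OF convex_halfspace_Re_gt convex_halfspace_Re_lt] by (simp add: Int_def)
  ultimately show "connected {z::complex. r < norm z \<and> norm z < 1}"
    using connected_continuous_image[OF continuous_on_exp[OF continuous_on_id] convex_connected]
    by metis
  show "open {z::complex. r < norm z \<and> norm z < 1}"
    by (intro open_Collect_conj open_Collect_less continuous_intros)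
qed

text \<open>On the strip covering the annulus, \<open>f \<circ> exp\<close> has a logarithm
  \<open>L\<close>. Along the period \<open>2 * pi * \<i>\<close> it grows by
  \<open>2 * pi * \<i> * m\<close>, so \<open>L s - m * s\<close> is periodic and descends to
  \<open>u\<close>. The integer \<open>m\<close> is the degree of \<open>f\<close> around the
  hole.\<close>

lemma annulus_log_representation:
  fixes r :: real and f :: "complex \<Rightarrow> complex"
  defines "\<Omega> \<equiv> {z. r < norm z \<and> norm z < 1}"
  assumes r: "0 < r" and f: "f holomorphic_on \<Omega>" "\<And>z. z \<in> \<Omega> \<Longrightarrow> f z \<noteq> 0"
  obtains m :: int and u where "u holomorphic_on \<Omega>" "\<And>z. z \<in> \<Omega> \<Longrightarrow> f z = z powi m * exp (u z)"
proof -
  define \<Sigma> where "\<Sigma> = {s. ln r < Re s \<and> Re s < 0}"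
  have open\<Omega>: "open \<Omega>" unfolding \<Omega>_def using open_annulus[OF r] .
  have \<Sigma>: "convex \<Sigma>" "open \<Sigma>"
    unfolding \<Sigma>_def using convex_Int[OF convex_halfspace_Re_gt convex_halfspace_Re_lt]
    by (auto simp: Int_def intro!: open_Collect_conj open_Collect_less continuous_intros)
  have exp_iff: "exp s \<in> \<Omega> \<longleftrightarrow> s \<in> \<Sigma>" for s
    using r by (auto simp: \<Omega>_def \<Sigma>_def) (metis exp_less_cancel_iff exp_ln)+
  have "(f \<circ> exp) holomorphic_on \<Sigma>"
    by (rule holomorphic_on_compose_gen[OF _ f(1)]) (auto intro: holomorphic_intros simp: exp_iff)
  moreover have "(f \<circ> exp) s \<noteq> 0" if "s \<in> \<Sigma>" for s
    using f(2) that by (simp add: exp_iff)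
  ultimately obtain L where L: "L holomorphic_on \<Sigma>" "\<And>s. s \<in> \<Sigma> \<Longrightarrow> f (exp s) = exp (L s)"
    using convex_imp_simply_connected[OF \<Sigma>(1)] simply_connected_eq_holomorphic_log[OF \<Sigma>(2)] by auto
  have shift: "s + 2 * of_real pi * \<i> \<in> \<Sigma> \<longleftrightarrow> s \<in> \<Sigma>" for s by (simp add: \<Sigma>_def)
  have contL: "continuous_on \<Sigma> L" using L holomorphic_on_imp_continuous_on by blast
  have cs: "continuous_on \<Sigma> (\<lambda>s. L (s + 2 * of_real pi * \<i>))"
    by (rule continuous_on_compose2[OF contL]) (auto intro!: continuous_intros simp: shift)
  have "exp (L (s + 2 * of_real pi * \<i>)) = exp (L s)" if "s \<in> \<Sigma>" for s
    using L(2)[of s] L(2)[of "s + 2 * of_real pi * \<i>"] that shift by (simp add: exp_add)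
  then obtain m :: int where m: "\<And>s. s \<in> \<Sigma> \<Longrightarrow> L (s + 2 * of_real pi * \<i>) = L s + 2 * of_real pi * of_int m * \<i>"
    using exp_eq_imp_diff_constant[OF convex_connected[OF \<Sigma>(1)] cs contL] by blast
  define K :: "complex \<Rightarrow> complex" where "K s = L s - of_int m * s" for s
  have K1: "K (s + 2 * of_real pi * \<i>) = K s" if "s \<in> \<Sigma>" for s
    using m[OF that] by (simp add: K_def algebra_simps)
  have Knat: "K (s + 2 * of_real pi * of_nat n * \<i>) = K s" if "s \<in> \<Sigma>" for s and n :: nat
  proof (induction n)
    case (Suc n)
    have "s + 2 * of_real pi * of_nat n * \<i> \<in> \<Sigma>" using that by (simp add: \<Sigma>_def)
    from K1[OF this] Suc show ?case by (simp add: algebra_simps)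
  qed simp
  have K: "K s = K t" if st: "exp s = exp t" "s \<in> \<Sigma>" "t \<in> \<Sigma>" for s t
  proof -
    obtain n :: int where "s = t + of_int (2 * n) * pi * \<i>"
      using st(1) unfolding exp_eq by blast
    then have n: "s = t + 2 * of_real pi * of_int n * \<i>" by simp
    show ?thesis
    proof (cases "n \<ge> 0")
      case True
      then show ?thesis using Knat[OF that(3), of "nat n"] n by simp
    next
      case False
      then have "t = s + 2 * of_real pi * of_nat (nat (- n)) * \<i>" using n by simp
      then show ?thesis using Knat[OF that(2), of "nat (- n)"] by simp
    qed
  qed
  have Ln: "Ln z \<in> \<Sigma>" "exp (Ln z) = z" if "z \<in> \<Omega>" for z
  proof -
    show "exp (Ln z) = z" using that r by (intro exp_Ln) (auto simp: \<Omega>_def)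
    then show "Ln z \<in> \<Sigma>" using that exp_iff by metis
  qed
  show ?thesis
  proof
    show "(\<lambda>z. K (Ln z)) holomorphic_on \<Omega>"
      unfolding holomorphic_on_def
    proof
      fix z0 assume z0: "z0 \<in> \<Omega>"
      then have nz: "z0 \<noteq> 0" using r by (auto simp: \<Omega>_def)
      \<comment> \<open>\<open>Ln\<close> jumps across its cut. Near \<open>z0\<close> the branch
        \<open>Ln z0 + Ln (z / z0)\<close> is holomorphic, and the periodic \<open>K\<close> does
        not distinguish it from \<open>Ln z\<close>.\<close>
      define N where "N = \<Omega> \<inter> {z. Re (z / z0) > 0}"
      have N: "open N" "z0 \<in> N"
        unfolding N_def using open\<Omega> z0 nz
        by (auto intro!: open_Int open_Collect_less continuous_intros)
      have l: "exp (Ln z0 + Ln (z / z0)) = z" if "z \<in> N" for z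
      proof -
        have "z \<noteq> 0" using that r by (auto simp: N_def \<Omega>_def)
        then show ?thesis using nz by (simp add: exp_add exp_Ln)
      qed
      have in\<Sigma>: "Ln z0 + Ln (z / z0) \<in> \<Sigma>" if "z \<in> N" for z
        using l[OF that] that exp_iff by (metis IntE N_def)
      have "(K \<circ> (\<lambda>z. Ln z0 + Ln (z / z0))) holomorphic_on N"
      proof (rule holomorphic_on_compose_gen)
        show "(\<lambda>z. Ln z0 + Ln (z / z0)) holomorphic_on N"
          by (intro holomorphic_intros) (auto simp: N_def complex_nonpos_Reals_iff nz)
        show "K holomorphic_on \<Sigma>"
          unfolding K_def by (intro holomorphic_intros L)
      qed (use in\<Sigma> in auto)
      then have "(\<lambda>z. K (Ln z)) holomorphic_on N"
      proof (rule holomorphic_transform)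
        fix z assume "z \<in> N"
        then show "(K \<circ> (\<lambda>z. Ln z0 + Ln (z / z0))) z = K (Ln z)"
          using K[OF _ in\<Sigma> Ln(1)] l Ln(2) by (simp add: N_def)
      qed
      then show "(\<lambda>z. K (Ln z)) field_differentiable at z0 within \<Omega>"
        using N holomorphic_on_imp_differentiable_at field_differentiable_at_within by blast
    qed
    fix z assume z: "z \<in> \<Omega>"
    have "f z = exp (L (Ln z))" using L(2)[OF Ln(1)[OF z]] Ln(2)[OF z] by simp
    also have "\<dots> = exp (of_int m * Ln z) * exp (K (Ln z))" by (simp add: K_def exp_diff)
    also have "exp (of_int m * Ln z) = exp (Ln z) powi m" by (simp add: exp_power_int)
    finally show "f z = z powi m * exp (K (Ln z))" using Ln(2)[OF z] by simp
  qed
qed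

text \<open>Divided by \<open>c\<close>, the function stays in the right half-plane on the circle,
  so its principal logarithm returns to its initial value after one turn. The explicit logarithm
  \<open>q\<close> gains \<open>2 * pi * \<i> * M\<close>, and the two differ by a constant.\<close>

lemma power_int_exp_near_constant_imp_zero:
  fixes U :: "complex \<Rightarrow> complex"
  assumes \<rho>: "0 < \<rho>" and U: "continuous_on (sphere 0 \<rho>) U" and c: "c \<noteq> 0"
    and near: "\<And>z. norm z = \<rho> \<Longrightarrow> norm (z powi M * exp (U z) - c) < norm c"
  shows "M = 0"
proof -
  define \<gamma> where "\<gamma> t = complex_of_real \<rho> * exp (2 * of_real pi * \<i> * of_real t)" for t :: real
  have \<gamma>: "norm (\<gamma> t) = \<rho>" for t using \<rho> by (simp add: \<gamma>_def norm_mult)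
  have cont\<gamma>: "continuous_on {0..1} \<gamma>" unfolding \<gamma>_def by (intro continuous_intros)
  define f where "f t = (\<gamma> t powi M * exp (U (\<gamma> t))) / c" for t
  have contU: "continuous_on {0..1} (\<lambda>t. U (\<gamma> t))"
    by (rule continuous_on_compose2[OF U cont\<gamma>]) (auto simp: \<gamma>)
  have \<gamma>nz: "\<gamma> t \<noteq> 0" for t using \<gamma>[of t] \<rho> by auto
  have contf: "continuous_on {0..1} f"
    unfolding f_def using c \<gamma>nz by (intro continuous_intros cont\<gamma> contU) auto
  have f1: "norm (f t - 1) < 1" for t
  proof -
    have "f t - 1 = (\<gamma> t powi M * exp (U (\<gamma> t)) - c) / c" using c by (simp add: f_def field_simps)
    then show ?thesis using near[OF \<gamma>[of t]] c by (simp add: norm_divide)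
  qed
  have fRe: "Re (f t) > 0" for t
    using f1[of t] abs_Re_le_cmod[of "f t - 1"] by simp
  define p where "p t = Ln (f t)" for t
  define q where "q t = of_int M * (of_real (ln \<rho>) + 2 * of_real pi * \<i> * of_real t) + U (\<gamma> t) - Ln c"
    for t :: real
  have "continuous_on {0..1} p"
    unfolding p_def
    by (rule continuous_on_compose2[OF continuous_on_Ln contf, of "{z. Re z > 0}"])
       (use fRe in \<open>auto simp: complex_nonpos_Reals_iff\<close>)
  moreover have "continuous_on {0..1} q"
    unfolding q_def by (intro continuous_intros contU)
  moreover have "exp (p t) = exp (q t)" if "t \<in> {0..1}" for t
  proof -
    have "f t \<noteq> 0" using fRe[of t] by auto
    have e: "exp (of_real (ln \<rho>) + 2 * of_real pi * \<i> * of_real t) = \<gamma> t"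
      using \<rho> by (simp add: \<gamma>_def exp_add exp_of_real)
    have "exp (q t) = exp (of_real (ln \<rho>) + 2 * of_real pi * \<i> * of_real t) powi M * exp (U (\<gamma> t)) / exp (Ln c)"
      by (simp only: q_def exp_diff exp_power_int
            exp_add[of "of_int M * (of_real (ln \<rho>) + 2 * of_real pi * \<i> * of_real t)"])
    then show ?thesis
      using \<open>f t \<noteq> 0\<close> c e by (simp add: p_def f_def)
  qed
  ultimately obtain n :: int where n: "\<And>t. t \<in> {0..1} \<Longrightarrow> p t = q t + 2 * of_real pi * of_int n * \<i>"
    using exp_eq_imp_diff_constant[of "{0..1}" p q] by auto
  have "\<gamma> 1 = \<gamma> 0" by (simp add: \<gamma>_def)
  then have "q 1 = q 0" using n[of 0] n[of 1] by (simp add: p_def f_def)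
  then show "M = 0"
    using \<open>\<gamma> 1 = \<gamma> 0\<close> by (simp add: q_def algebra_simps)
qed

text \<open>Uniformity permits the argument to move together with the function; this is needed to
  pass to the limit in a composition of iterates.\<close>

lemma uniform_limit_tendsto_compose:
  assumes ul: "uniform_limit K F h sequentially" and h: "continuous_on K h"
    and x: "x \<longlonglongrightarrow> y" and y: "y \<in> K" and ev: "\<forall>\<^sub>F n in sequentially. x n \<in> K"
  shows "(\<lambda>n. F n (x n)) \<longlonglongrightarrow> h y"
proof (rule tendstoI)
  fix e :: real assume "0 < e"
  have "(\<lambda>n. h (x n)) \<longlonglongrightarrow> h y"
    by (rule continuous_on_tendsto_compose[OF h x y ev])
  then have "\<forall>\<^sub>F n in sequentially. dist (h (x n)) (h y) < e / 2"
    using \<open>0 < e\<close> by (intro tendstoD) auto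
  moreover have "\<forall>\<^sub>F n in sequentially. \<forall>z\<in>K. dist (F n z) (h z) < e / 2"
    using uniform_limitD[OF ul, of "e / 2"] \<open>0 < e\<close> by simp
  ultimately show "\<forall>\<^sub>F n in sequentially. dist (F n (x n)) (h y) < e"
    using ev
  proof eventually_elim
    case (elim n)
    then have "dist (F n (x n)) (h (x n)) < e / 2" by blast
    with elim show ?case by (metis dist_triangle_half_r dist_commute)
  qed
qed

text \<open>The iterates have degree \<open>m ^ n\<close>, never \<open>0\<close>, so a Montel limit
  \<open>g\<close> of \<open>T ^^ s n\<close> is not constant. A limit \<open>h\<close> of iterates
  with exponents \<open>s (Suc k) - s k\<close> satisfies \<open>h (g z) = g z\<close> and is the
  identity on an open set, hence everywhere. A value omitted by \<open>T\<close> is omitted by these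
  iterates and so, by Hurwitz, by the identity, which is absurd.\<close>

lemma annulus_selfmap_surj:
  fixes r :: real and T :: "complex \<Rightarrow> complex"
  defines "\<Omega> \<equiv> {z. r < norm z \<and> norm z < 1}"
  assumes r: "0 < r" "r < 1" and T: "T holomorphic_on \<Omega>" "T ` \<Omega> \<subseteq> \<Omega>"
    and u: "u holomorphic_on \<Omega>" and Tu: "\<And>z. z \<in> \<Omega> \<Longrightarrow> T z = z powi m * exp (u z)" and m: "m \<noteq> 0"
  shows "T ` \<Omega> = \<Omega>"
proof -
  have \<Omega>: "open \<Omega>" "connected \<Omega>"
    unfolding \<Omega>_def using open_annulus[OF r(1)] connected_annulus[OF r(1)] by auto
  define \<rho> where "\<rho> = (r + 1) / 2"
  have \<rho>: "0 < \<rho>" "r < \<rho>" "\<rho> < 1" using r by (auto simp: \<rho>_def)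
  then have sph: "sphere 0 \<rho> \<subseteq> \<Omega>" by (auto simp: \<Omega>_def)
  have nz: "z \<noteq> 0" if "z \<in> \<Omega>" for z using that r by (auto simp: \<Omega>_def)
  have it: "(T ^^ n) holomorphic_on \<Omega>" "(T ^^ n) ` \<Omega> \<subseteq> \<Omega>"
      "\<exists>U. U holomorphic_on \<Omega> \<and> (\<forall>z\<in>\<Omega>. (T ^^ n) z = z powi (m ^ n) * exp (U z))" for n
  proof (induction n)
    case 0
    show "(T ^^ 0) holomorphic_on \<Omega>" "(T ^^ 0) ` \<Omega> \<subseteq> \<Omega>" by (simp_all add: id_def)
    show "\<exists>U. U holomorphic_on \<Omega> \<and> (\<forall>z\<in>\<Omega>. (T ^^ 0) z = z powi (m ^ 0) * exp (U z))"
      by (rule exI[of _ "\<lambda>z. 0"]) auto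
  next
    case (Suc n)
    show "(T ^^ Suc n) holomorphic_on \<Omega>"
      using holomorphic_on_compose_gen[OF Suc(1) T(1) Suc(2)] by simp
    show "(T ^^ Suc n) ` \<Omega> \<subseteq> \<Omega>" using Suc(2) T(2) by (auto simp: image_subset_iff)
    obtain U where U: "U holomorphic_on \<Omega>" "\<And>z. z \<in> \<Omega> \<Longrightarrow> (T ^^ n) z = z powi (m ^ n) * exp (U z)"
      using Suc(3) by blast
    show "\<exists>U. U holomorphic_on \<Omega> \<and> (\<forall>z\<in>\<Omega>. (T ^^ Suc n) z = z powi (m ^ Suc n) * exp (U z))"
    proof (intro exI[of _ "\<lambda>z. of_int m * U z + (u \<circ> (T ^^ n)) z"] conjI ballI)
      show "(\<lambda>z. of_int m * U z + (u \<circ> (T ^^ n)) z) holomorphic_on \<Omega>"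
        by (intro holomorphic_intros U holomorphic_on_compose_gen[OF Suc(1) u Suc(2)])
      fix z assume z: "z \<in> \<Omega>"
      have "(T ^^ Suc n) z = ((T ^^ n) z) powi m * exp (u ((T ^^ n) z))"
        using Tu[of "(T ^^ n) z"] Suc(2) z by (auto simp: image_subset_iff)
      also have "((T ^^ n) z) powi m = z powi (m ^ Suc n) * exp (of_int m * U z)"
        unfolding U(2)[OF z]
        by (simp add: power_int_mult_distrib power_int_mult[symmetric] exp_power_int mult.commute)
      finally show "(T ^^ Suc n) z = z powi (m ^ Suc n) * exp (of_int m * U z + (u \<circ> (T ^^ n)) z)"
        by (simp add: exp_add mult_ac)
    qed
  qed
  define \<H> where "\<H> = range (\<lambda>n. T ^^ n)"
  have \<H>: "\<And>h. h \<in> \<H> \<Longrightarrow> h holomorphic_on \<Omega>" using it by (auto simp: \<H>_def)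
  have bd: "\<exists>B. \<forall>h\<in>\<H>. \<forall>z\<in>K. norm (h z) \<le> B" if "K \<subseteq> \<Omega>" for K
  proof (intro exI[of _ 1] ballI)
    fix h z assume "h \<in> \<H>" "z \<in> K"
    then have "h z \<in> \<Omega>" using it(2) \<open>K \<subseteq> \<Omega>\<close> by (auto simp: \<H>_def image_subset_iff)
    then show "norm (h z) \<le> 1" by (simp add: \<Omega>_def)
  qed
  obtain g s where g: "g holomorphic_on \<Omega>" "strict_mono s"
      "\<And>x. x \<in> \<Omega> \<Longrightarrow> (\<lambda>n. (T ^^ s n) x) \<longlonglongrightarrow> g x"
      "\<And>K. compact K \<Longrightarrow> K \<subseteq> \<Omega> \<Longrightarrow> uniform_limit K ((\<lambda>n. T ^^ n) \<circ> s) g sequentially"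
    by (rule Montel[OF \<Omega>(1) \<H> bd, of "\<lambda>n. T ^^ n"]) (auto simp: \<H>_def)
  have gr: "r \<le> norm (g z)" "norm (g z) \<le> 1" if z: "z \<in> \<Omega>" for z
  proof -
    have n: "(\<lambda>n. norm ((T ^^ s n) z)) \<longlonglongrightarrow> norm (g z)" by (intro tendsto_intros g z)
    have b: "r \<le> norm ((T ^^ s n) z)" "norm ((T ^^ s n) z) \<le> 1" for n
      using it(2)[of "s n"] z by (auto simp: \<Omega>_def image_subset_iff less_imp_le)
    show "r \<le> norm (g z)" by (rule LIMSEQ_le_const[OF n]) (use b in auto)
    show "norm (g z) \<le> 1" by (rule LIMSEQ_le_const2[OF n]) (use b in auto)
  qed
  text \<open>A constant limit would force a large iterate to have winding number \<open>0\<close>, not \<open>m ^ n\<close>, around the origin.\<close>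
  have gnc: "\<not> g constant_on \<Omega>"
  proof
    assume "g constant_on \<Omega>"
    then obtain c where c: "\<And>z. z \<in> \<Omega> \<Longrightarrow> g z = c" by (auto simp: constant_on_def)
    have "of_real \<rho> \<in> \<Omega>" using sph \<rho> by (auto simp: subset_iff)
    then have "r \<le> norm c" using gr(1) c by metis
    then have cnz: "c \<noteq> 0" using r by auto
    have "uniform_limit (sphere 0 \<rho>) ((\<lambda>n. T ^^ n) \<circ> s) g sequentially"
      using g(4) sph by simp
    then have "\<forall>\<^sub>F n in sequentially. \<forall>z\<in>sphere 0 \<rho>. dist ((T ^^ s n) z) (g z) < norm c"
      using cnz uniform_limitD by fastforce
    then obtain n where n: "\<forall>z\<in>sphere 0 \<rho>. dist ((T ^^ s n) z) (g z) < norm c"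
      using eventually_happens'[OF sequentially_bot] by blast
    obtain U where U: "U holomorphic_on \<Omega>"
        "\<And>z. z \<in> \<Omega> \<Longrightarrow> (T ^^ s n) z = z powi (m ^ s n) * exp (U z)"
      using it(3)[of "s n"] by blast
    have "continuous_on (sphere 0 \<rho>) U"
      using U sph holomorphic_on_imp_continuous_on holomorphic_on_subset by blast
    then have "m ^ s n = 0"
    proof (rule power_int_exp_near_constant_imp_zero[OF \<rho>(1) _ cnz])
      fix z :: complex assume "norm z = \<rho>"
      then have "z \<in> sphere 0 \<rho>" "z \<in> \<Omega>" using sph by auto
      then show "norm (z powi (m ^ s n) * exp (U z) - c) < norm c"
        using bspec[OF n, of z] U(2)[of z] c[of z] by (simp add: dist_norm)
    qed
    then show False using m by simp
  qed
  \<comment> \<open>The limit lies a priori in the closed annulus only; being open, its image lies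
    in the interior.\<close>
  have "open (g ` \<Omega>)"
    using open_mapping_thm[OF g(1) \<Omega> \<Omega>(1) _ gnc] by blast
  moreover have "g ` \<Omega> \<subseteq> cball 0 1" "g ` \<Omega> \<subseteq> - ball 0 r" using gr by (force simp: not_less)+
  ultimately have "g ` \<Omega> \<subseteq> interior (cball 0 1)" "g ` \<Omega> \<subseteq> interior (- ball 0 r)"
    using interior_maximal by metis+
  then have g\<Omega>: "g ` \<Omega> \<subseteq> \<Omega>" using r by (force simp: interior_complement \<Omega>_def)
  \<comment> \<open>Strict monotonicity gives \<open>d k \<ge> 1\<close>. This matters at the end: a
    value omitted by \<open>T\<close> is omitted by positive iterates, but not by
    \<open>T ^^ 0\<close>.\<close>
  define d where "d k = s (Suc k) - s k" for k
  have d: "d k \<ge> 1" "s (Suc k) = d k + s k" for k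
    using strict_monoD[OF g(2), of k "Suc k"] by (simp_all add: d_def)
  obtain h t where h: "h holomorphic_on \<Omega>" "strict_mono t"
      "\<And>x. x \<in> \<Omega> \<Longrightarrow> (\<lambda>n. (T ^^ d (t n)) x) \<longlonglongrightarrow> h x"
      "\<And>K. compact K \<Longrightarrow> K \<subseteq> \<Omega> \<Longrightarrow> uniform_limit K ((\<lambda>n. T ^^ d n) \<circ> t) h sequentially"
    by (rule Montel[OF \<Omega>(1) \<H> bd, of "\<lambda>n. T ^^ d n"]) (auto simp: \<H>_def)
  have hg: "h (g z) = g z" if z: "z \<in> \<Omega>" for z
  proof -
    have gz: "g z \<in> \<Omega>" using g\<Omega> z by blast
    then obtain e where e: "0 < e" "cball (g z) e \<subseteq> \<Omega>" using \<Omega>(1) open_contains_cball by blast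
    have ul: "uniform_limit (cball (g z) e) ((\<lambda>n. T ^^ d n) \<circ> t) h sequentially"
      using h(4) e by simp
    have lim1: "(\<lambda>n. (T ^^ s (t n)) z) \<longlonglongrightarrow> g z"
      using LIMSEQ_subseq_LIMSEQ[OF g(3)[OF z] h(2)] by (simp add: o_def)
    have "\<forall>\<^sub>F n in sequentially. (T ^^ s (t n)) z \<in> cball (g z) e"
      using lim1 e(1) tendstoD[OF lim1 e(1)] by (auto simp: dist_commute elim: eventually_mono)
    then have "(\<lambda>n. ((\<lambda>n. T ^^ d n) \<circ> t) n ((T ^^ s (t n)) z)) \<longlonglongrightarrow> h (g z)"
      using uniform_limit_tendsto_compose[OF ul _ lim1] h(1) e
      by (meson centre_in_cball continuous_on_subset holomorphic_on_imp_continuous_on less_imp_le)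
    moreover have "((\<lambda>n. T ^^ d n) \<circ> t) n ((T ^^ s (t n)) z) = (T ^^ s (Suc (t n))) z" for n
      by (simp add: d(2) funpow_add)
    moreover have "(\<lambda>n. (T ^^ s (Suc (t n))) z) \<longlonglongrightarrow> g z"
      using LIMSEQ_subseq_LIMSEQ[OF g(3)[OF z], of "\<lambda>n. Suc (t n)"] h(2)
      by (simp add: o_def strict_mono_Suc_iff)
    ultimately show ?thesis using LIMSEQ_unique by simp
  qed
  have hid: "h w = w" if "w \<in> \<Omega>" for w
  proof (rule analytic_continuation_open[OF \<open>open (g ` \<Omega>)\<close> \<Omega>(1) _ \<Omega>(2) g\<Omega> h(1) holomorphic_on_ident _ that])
    show "g ` \<Omega> \<noteq> {}" using that by auto
  qed (use hg in auto)
  show ?thesis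
  proof (rule equalityI[OF T(2)], rule subsetI, rule ccontr)
    fix w assume w: "w \<in> \<Omega>" "w \<notin> T ` \<Omega>"
    have "h w - w \<noteq> 0"
    proof (rule Hurwitz_no_zeros[OF \<Omega>, of "\<lambda>n z. (T ^^ d (t n)) z - w" "\<lambda>z. h z - w"])
      show "(\<lambda>z. (T ^^ d (t n)) z - w) holomorphic_on \<Omega>" for n
        by (intro holomorphic_intros it)
      show "(\<lambda>z. h z - w) holomorphic_on \<Omega>" by (intro holomorphic_intros h)
      show "uniform_limit K (\<lambda>n z. (T ^^ d (t n)) z - w) (\<lambda>z. h z - w) sequentially"
        if "compact K" "K \<subseteq> \<Omega>" for K
        using h(4)[OF that] by (intro uniform_limit_intros) (simp add: o_def)
      \<comment> \<open>The annulus is symmetric under negation, so the identity can be compared at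
        \<open>w\<close> and \<open>- w\<close>, which differ because \<open>w\<close> is
        nonzero.\<close>
      show "\<not> (\<lambda>z. h z - w) constant_on \<Omega>"
      proof
        assume "(\<lambda>z. h z - w) constant_on \<Omega>"
        then obtain c where c: "\<And>z. z \<in> \<Omega> \<Longrightarrow> h z - w = c" by (auto simp: constant_on_def)
        have "- w \<in> \<Omega>" using w by (auto simp: \<Omega>_def)
        then have "- w = w" using c[of w] c[of "- w"] hid[of w] hid[of "- w"] w by simp
        then show False using nz[OF w(1)] by simp
      qed
      show "(T ^^ d (t n)) z - w \<noteq> 0" if "z \<in> \<Omega>" for n z
      proof -
        obtain k where k: "d (t n) = Suc k" using d(1)[of "t n"] by (cases "d (t n)") auto
        have "(T ^^ d (t n)) z \<in> T ` \<Omega>" using it(2)[of k] that unfolding k by auto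
        then show ?thesis using w by auto
      qed
    qed (use w in auto)
    then show False using hid w by simp
  qed
qed

section \<open>Normal families of univalent functions\<close>

text \<open>If the image contained \<open>ball 0 5\<close>, the inverse would map
  \<open>cball 0 4\<close> into \<open>ball 0 2\<close>, and Cauchy's inequality would bound its
  derivative at \<open>0\<close> by \<open>2 / 4\<close>, although that derivative is
  \<open>1\<close>.\<close>

lemma univalent_normalized_omits:
  fixes F :: "complex \<Rightarrow> complex"
  assumes F: "F holomorphic_on ball 0 2" "inj_on F (ball 0 2)" "F 0 = 0" "deriv F 0 = 1"
  obtains w where "norm w < 5" "w \<notin> F ` ball 0 2"
proof (rule ccontr)
  assume "\<not> thesis"
  then have sub: "ball 0 5 \<subseteq> F ` ball 0 2" using that by (auto simp: subset_iff)
  obtain G where G: "G holomorphic_on F ` ball 0 2"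
      "\<And>z. z \<in> ball 0 2 \<Longrightarrow> deriv F z * deriv G (F z) = 1" "\<And>z. z \<in> ball 0 2 \<Longrightarrow> G (F z) = z"
    using holomorphic_has_inverse[OF F(1) open_ball F(2)] by metis
  have dG: "deriv G 0 = 1" using G(2)[of 0] F by simp
  have cb: "cball 0 4 \<subseteq> F ` ball 0 2" using sub by (auto simp: subset_iff)
  have "norm ((deriv ^^ 1) G 0) \<le> fact 1 * 2 / 4 ^ 1"
  proof (rule Cauchy_inequality)
    show "G holomorphic_on ball 0 4"
      using G(1) cb holomorphic_on_subset ball_subset_cball by blast
    show "continuous_on (cball 0 4) G"
      using G(1) cb holomorphic_on_subset holomorphic_on_imp_continuous_on by blast
    fix x :: complex assume "norm (0 - x) = 4"
    then obtain z where "x = F z" "z \<in> ball 0 2" using cb by (force simp: subset_iff)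
    then show "norm (G x) \<le> 2" using G(3) by simp
  qed simp
  then show False using dG by simp
qed

text \<open>The factor \<open>exp (pi * ...)\<close> is the bound of Schottky's theorem for initial
  value at most \<open>1\<close> and radius \<open>1/2\<close>. The rest comes from
  \<open>F z = w * (1 - (s z)\<^sup>2)\<close> with an omitted value \<open>w\<close> of norm below
  \<open>5\<close>.\<close>

definition univalent_bound :: real where
  "univalent_bound = 5 * (1 + (exp (pi * exp (pi * (2 + 2 * 1 + 12 * (1/2) / (1 - 1/2)))))\<^sup>2)"

text \<open>If \<open>F\<close> omits \<open>w\<close>, then the branch \<open>s\<close> of \<open>sqrt (1 - F / w)\<close> with \<open>s 0 = -1\<close> omits both
  \<open>0\<close> and \<open>1\<close>, since \<open>s z = 1\<close> would give \<open>F z = 0 = F 0\<close>; Schottky's theorem then bounds \<open>s\<close>.\<close>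
lemma univalent_normalized_bound:
  fixes F :: "complex \<Rightarrow> complex"
  assumes F: "F holomorphic_on ball 0 2" "inj_on F (ball 0 2)" "F 0 = 0" "deriv F 0 = 1"
    and z: "norm z \<le> 1/2"
  shows "norm (F z) \<le> univalent_bound"
proof -
  obtain w where w: "norm w < 5" "w \<notin> F ` ball 0 2"
    using univalent_normalized_omits[OF F] by blast
  have w0: "w \<noteq> 0" using w F(3) by force
  have "(\<lambda>z. 1 - F z / w) holomorphic_on ball 0 2" by (intro holomorphic_intros F) (use w0 in auto)
  moreover have "1 - F z / w \<noteq> 0" if "z \<in> ball 0 2" for z
    using w that w0 by auto
  ultimately obtain q where q: "q holomorphic_on ball 0 2" "\<And>z. z \<in> ball 0 2 \<Longrightarrow> 1 - F z / w = (q z)\<^sup>2"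
    using convex_imp_simply_connected[OF convex_ball] simply_connected_eq_holomorphic_sqrt[OF open_ball]
    by (metis (no_types, lifting))
  have "(q 0)\<^sup>2 = 1" using q(2)[of 0] F by simp
  define s where "s z = - q z / q 0" for z
  have q0: "q 0 \<noteq> 0" using \<open>(q 0)\<^sup>2 = 1\<close> by auto
  have s: "s holomorphic_on ball 0 2" unfolding s_def using q0 by (intro holomorphic_intros q) auto
  have s2: "(s z)\<^sup>2 = 1 - F z / w" if "z \<in> ball 0 2" for z
    using q(2)[OF that] \<open>(q 0)\<^sup>2 = 1\<close> by (simp add: s_def power_divide)
  have s0: "s 0 = -1" using q0 by (simp add: s_def)
  have s01: "\<not> (s z = 0 \<or> s z = 1)" if "z \<in> cball 0 1" for z
  proof -
    have z: "z \<in> ball 0 2" using that by auto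
    have "s z \<noteq> 0" using s2[OF z] w w0 z by auto
    moreover have "s z \<noteq> 1"
    proof
      assume "s z = 1"
      then have "F z = F 0" using s2[OF z] w0 F by simp
      then have "z = 0" using F(2) z by (auto dest: inj_onD)
      then show False using s0 \<open>s z = 1\<close> by simp
    qed
    ultimately show ?thesis by blast
  qed
  define C where "C = exp (pi * exp (pi * (2 + 2 * 1 + 12 * (1/2) / (1 - 1/2 :: real))))"
  have "norm (s z) \<le> C"
    unfolding C_def
  proof (rule Schottky[OF _ _ s01])
    show "s holomorphic_on cball 0 1" by (rule holomorphic_on_subset[OF s]) auto
  qed (use s0 z in auto)
  then have "(norm (s z))\<^sup>2 \<le> C\<^sup>2" by (intro power_mono) auto
  have zb: "z \<in> ball 0 2" using z by auto
  have "F z = w * (1 - (s z)\<^sup>2)" using s2[OF zb] w0 by simp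
  then have "norm (F z) = norm w * norm (1 - (s z)\<^sup>2)" by (simp add: norm_mult)
  also have "norm (1 - (s z)\<^sup>2) \<le> 1 + (norm (s z))\<^sup>2"
    using norm_triangle_ineq4[of 1 "(s z)\<^sup>2"] by (simp add: norm_power)
  then have "norm w * norm (1 - (s z)\<^sup>2) \<le> 5 * (1 + C\<^sup>2)"
    using w \<open>(norm (s z))\<^sup>2 \<le> C\<^sup>2\<close> by (intro mult_mono) auto
  finally show ?thesis by (simp add: univalent_bound_def C_def)
qed

lemma univalent_bound_nonneg: "univalent_bound \<ge> 0"
  by (simp add: univalent_bound_def)

text \<open>Affine rescaling reduces to the normalised case: \<open>ball 0 2\<close> corresponds to
  \<open>ball q R\<close>, and the radius \<open>1/2\<close> there to \<open>R / 4\<close>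
  here.\<close>

lemma univalent_disc_bound:
  fixes f :: "complex \<Rightarrow> complex"
  assumes f: "f holomorphic_on ball q R" "inj_on f (ball q R)" and R: "0 < R"
    and z: "dist q z \<le> R / 4"
  shows "norm (f z - f q) \<le> univalent_bound * R * norm (deriv f q)"
proof -
  have d0: "deriv f q \<noteq> 0"
    using holomorphic_injective_imp_regular[OF f(1) open_ball f(2)] R by auto
  define a where "a = complex_of_real (R / 2) * deriv f q"
  have a0: "a \<noteq> 0" using d0 R by (simp add: a_def)
  define l where "l z = q + complex_of_real (R / 2) * z" for z
  have l: "l z \<in> ball q R" if "z \<in> ball 0 2" for z
    using that R by (auto simp: l_def dist_norm norm_mult)
  define F where "F z = (f (l z) - f q) / a" for z
  have "(f \<circ> l) holomorphic_on ball 0 2"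
  proof (rule holomorphic_on_compose_gen[OF _ f(1)])
    show "l holomorphic_on ball 0 2" unfolding l_def by (intro holomorphic_intros)
  qed (use l in auto)
  then have F1: "F holomorphic_on ball 0 2"
    unfolding F_def o_def using a0 by (intro holomorphic_intros)
  have F2: "inj_on F (ball 0 2)"
  proof (rule inj_onI)
    fix x y assume xy: "x \<in> ball 0 2" "y \<in> ball 0 2" "F x = F y"
    then have "f (l x) = f (l y)" using a0 by (simp add: F_def)
    then have "l x = l y" using f(2) l xy by (auto dest: inj_onD)
    then show "x = y" using R by (simp add: l_def)
  qed
  have "(f has_field_derivative deriv f q) (at (l 0))"
    using holomorphic_derivI[OF f(1) open_ball, of q] R by (simp add: l_def)
  moreover have "(l has_field_derivative complex_of_real (R / 2)) (at 0)"
    unfolding l_def by (auto intro!: derivative_eq_intros)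
  ultimately have "((\<lambda>z. f (l z)) has_field_derivative a) (at 0)"
    unfolding a_def using DERIV_chain2[of f "deriv f q" l 0 "complex_of_real (R / 2)" UNIV]
    by (simp only: mult.commute)
  then have "(F has_field_derivative 1) (at 0)"
    unfolding F_def using a0 by (auto intro!: derivative_eq_intros)
  then have F4: "deriv F 0 = 1" by (rule DERIV_imp_deriv)
  have F3: "F 0 = 0" by (simp add: F_def l_def)
  define \<zeta> where "\<zeta> = (z - q) / complex_of_real (R / 2)"
  have "norm \<zeta> \<le> 1 / 2"
  proof -
    have "norm \<zeta> = norm (z - q) / (R / 2)" using R by (simp add: \<zeta>_def norm_divide del: of_real_divide)
    also have "\<dots> \<le> (R / 4) / (R / 2)"
      using z R by (intro divide_right_mono) (auto simp: dist_norm norm_minus_commute)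
    finally show ?thesis using R by simp
  qed
  then have "norm (F \<zeta>) \<le> univalent_bound"
    by (rule univalent_normalized_bound[OF F1 F2 F3 F4])
  moreover have "l \<zeta> = z" using R by (simp add: l_def \<zeta>_def field_simps)
  then have "f z - f q = a * F \<zeta>" using a0 by (simp add: F_def)
  moreover have "norm a \<le> R * norm (deriv f q)"
    using R by (simp add: a_def norm_mult mult_right_mono)
  ultimately have "norm (f z - f q) \<le> (R * norm (deriv f q)) * univalent_bound"
    using R by (auto simp: norm_mult intro!: mult_mono)
  then show ?thesis by (simp add: mult_ac)
qed

text \<open>The distortion bound passes from a point to its neighbourhood and back, hence along the
  connected set.\<close>
lemma univalent_family_locally_bounded:
  fixes \<Omega> :: "complex set"
  assumes \<Omega>: "open \<Omega>" "connected \<Omega>" "p \<in> \<Omega>"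
    and \<F>: "\<And>h. h \<in> \<F> \<Longrightarrow> h holomorphic_on \<Omega> \<and> inj_on h \<Omega> \<and> norm (h p) \<le> B0 \<and> norm (deriv h p) \<le> B0"
    and K: "compact K" "K \<subseteq> \<Omega>"
  shows "\<exists>B. \<forall>h\<in>\<F>. \<forall>z\<in>K. norm (h z) \<le> B"
proof -
  \<comment> \<open>Derivatives are carried along with values because the disc bound at a new centre
    needs the derivative there.\<close>
  define P where "P q \<longleftrightarrow> (\<exists>B. \<forall>h\<in>\<F>. norm (h q) \<le> B \<and> norm (deriv h q) \<le> B)" for q
  have near: "\<exists>B. \<forall>h\<in>\<F>. \<forall>z\<in>ball q (R/8). norm (h z) \<le> B \<and> norm (deriv h z) \<le> B"
    if q: "P q" "0 < R" "ball q R \<subseteq> \<Omega>" for q R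
  proof -
    obtain B where B: "\<And>h. h \<in> \<F> \<Longrightarrow> norm (h q) \<le> B \<and> norm (deriv h q) \<le> B"
      using q(1) by (auto simp: P_def)
    define C where "C = B + univalent_bound * R * B"
    have C: "norm (h z) \<le> C" if "h \<in> \<F>" "dist q z \<le> R / 4" for h z
    proof -
      have "norm (h z - h q) \<le> univalent_bound * R * norm (deriv h q)"
        using \<F>[OF that(1)] q that
        by (intro univalent_disc_bound) (auto intro: holomorphic_on_subset inj_on_subset)
      also have "\<dots> \<le> univalent_bound * R * B"
        using B[OF that(1)] univalent_bound_nonneg q by (intro mult_left_mono) auto
      finally show ?thesis
        using B[OF that(1)] norm_triangle_sub[of "h z" "h q"] by (simp add: C_def)
    qed
    \<comment> \<open>For \<open>z\<close> within \<open>R / 8\<close> of \<open>q\<close>, the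
      circle of radius \<open>R / 8\<close> about \<open>z\<close> stays within \<open>R / 4\<close>
      of \<open>q\<close>, where the values are bounded by \<open>C\<close>; Cauchy's inequality
      then bounds the derivative.\<close>
    have D: "norm (deriv h z) \<le> C / (R / 8)" if "h \<in> \<F>" "z \<in> ball q (R / 8)" for h z
    proof -
      have sub: "dist q x \<le> R / 4" if "x \<in> cball z (R / 8)" for x
        using that \<open>z \<in> ball q (R / 8)\<close> dist_triangle[of q x z] by auto
      then have "cball z (R / 8) \<subseteq> ball q R" using q(2) by fastforce
      then have hol: "h holomorphic_on cball z (R / 8)"
        using \<F>[OF that(1)] q(3) holomorphic_on_subset by (metis order_trans)
      have "norm ((deriv ^^ 1) h z) \<le> fact 1 * C / (R / 8) ^ 1"
      proof (rule Cauchy_inequality)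
        show "h holomorphic_on ball z (R / 8)" "continuous_on (cball z (R / 8)) h"
          using hol holomorphic_on_subset ball_subset_cball holomorphic_on_imp_continuous_on by blast+
        show "norm (h x) \<le> C" if "norm (z - x) = R / 8" for x
          using C[OF \<open>h \<in> \<F>\<close> sub[of x]] that by (simp add: dist_norm)
      qed (use q in auto)
      then show ?thesis by simp
    qed
    show ?thesis
    proof (intro exI[of _ "max C (C / (R / 8))"] ballI conjI)
      fix h z assume hz: "h \<in> \<F>" "z \<in> ball q (R / 8)"
      have "norm (h z) \<le> C" by (rule C) (use hz q(2) in auto)
      then show "norm (h z) \<le> max C (C / (R / 8))" by simp
      show "norm (deriv h z) \<le> max C (C / (R / 8))" using D[OF hz] by simp
    qed
  qed
  have "P p" unfolding P_def using \<F> by blast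
  have P: "P q" if "q \<in> \<Omega>" for q
  proof -
    have "P p \<longleftrightarrow> P q"
    proof (rule connected_equivalence_relation[OF \<Omega>(2,3) that, where R = "\<lambda>x y. P x \<longleftrightarrow> P y"])
      fix a assume "a \<in> \<Omega>"
      then obtain R where R: "0 < R" "ball a R \<subseteq> \<Omega>" using \<Omega>(1) open_contains_ball by blast
      \<comment> \<open>The radius \<open>R / 16\<close> works in both directions: a point
        \<open>x\<close> this close to \<open>a\<close> has \<open>ball x (R / 2)\<close> inside the
        domain, and \<open>a\<close> lies in \<open>ball x (R / 2 / 8)\<close>.\<close>
      have "P a \<longleftrightarrow> P x" if x: "x \<in> ball a (R / 16)" for x
      proof
        assume "P a"
        from near[OF this R] obtain B
          where B: "\<forall>h\<in>\<F>. \<forall>z\<in>ball a (R / 8). norm (h z) \<le> B \<and> norm (deriv h z) \<le> B" by auto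
        have "x \<in> ball a (R / 8)" using x R(1) by auto
        with B show "P x" unfolding P_def by blast
      next
        assume "P x"
        have "ball x (R / 2) \<subseteq> \<Omega>"
        proof (rule order_trans[OF _ R(2)], rule subsetI)
          fix y assume "y \<in> ball x (R / 2)"
          then show "y \<in> ball a R" using x R(1) dist_triangle[of a y x] by auto
        qed
        from near[OF \<open>P x\<close> _ this] R
        obtain B where B: "\<forall>h\<in>\<F>. \<forall>z\<in>ball x (R / 2 / 8). norm (h z) \<le> B \<and> norm (deriv h z) \<le> B" by auto
        have "a \<in> ball x (R / 2 / 8)" using x by (simp add: dist_commute)
        with B show "P a" unfolding P_def by blast
      qed
      then show "\<exists>T. openin (top_of_set \<Omega>) T \<and> a \<in> T \<and> (\<forall>x\<in>T. P a \<longleftrightarrow> P x)"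
        using R \<open>a \<in> \<Omega>\<close> by (intro exI[of _ "\<Omega> \<inter> ball a (R / 16)"]) (auto simp: openin_open_Int)
    qed auto
    then show ?thesis using \<open>P p\<close> by simp
  qed
  have "\<exists>B N. open N \<and> q \<in> N \<and> (\<forall>h\<in>\<F>. \<forall>z\<in>N. norm (h z) \<le> B)" if "q \<in> K" for q
  proof -
    have "q \<in> \<Omega>" using that K by blast
    then obtain R where R: "0 < R" "ball q R \<subseteq> \<Omega>" using \<Omega>(1) open_contains_ball by blast
    obtain B where "\<forall>h\<in>\<F>. \<forall>z\<in>ball q (R/8). norm (h z) \<le> B \<and> norm (deriv h z) \<le> B"
      using near[OF P[OF \<open>q \<in> \<Omega>\<close>] R] by blast
    then show ?thesis using R by (intro exI[of _ B] exI[of _ "ball q (R/8)"]) auto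
  qed
  then obtain B N where BN: "\<And>q. q \<in> K \<Longrightarrow> open (N q) \<and> q \<in> N q \<and> (\<forall>h\<in>\<F>. \<forall>z\<in>N q. norm (h z) \<le> B q)"
    by metis
  obtain Q where Q: "Q \<subseteq> K" "finite Q" "K \<subseteq> (\<Union>q\<in>Q. N q)"
    using compactE_image[OF K(1), of K N] BN by (metis UN_I subsetI)
  show ?thesis
  proof (intro exI[of _ "Max (insert 0 (B ` Q))"] ballI)
    fix h z assume "h \<in> \<F>" "z \<in> K"
    then obtain q where "q \<in> Q" "z \<in> N q" using Q by blast
    then have "norm (h z) \<le> B q" using BN Q \<open>h \<in> \<F>\<close> by blast
    also have "\<dots> \<le> Max (insert 0 (B ` Q))" using Q \<open>q \<in> Q\<close> by (intro Max_ge) auto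
    finally show "norm (h z) \<le> Max (insert 0 (B ` Q))" .
  qed
qed

section \<open>Direct limits of univalent maps\<close>

text \<open>The composite \<open>T (k + n - 1) \<circ> ... \<circ> T k\<close> with \<open>n\<close>
  factors, leading from copy \<open>k\<close> to copy \<open>k + n\<close>.\<close>

primrec chain_comp :: "(nat \<Rightarrow> 'a \<Rightarrow> 'a) \<Rightarrow> nat \<Rightarrow> nat \<Rightarrow> 'a \<Rightarrow> 'a" where
  "chain_comp T k 0 = id"
| "chain_comp T k (Suc n) = T (k + n) \<circ> chain_comp T k n"

lemma chain_comp_add: "chain_comp T k (m + n) = chain_comp T (k + m) n \<circ> chain_comp T k m"
  by (induction n) (simp_all add: o_assoc add.assoc)

lemma chain_comp_shift: "chain_comp T (Suc k) n \<circ> T k = chain_comp T k (Suc n)"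
  using chain_comp_add[of T k 1 n] by simp

lemma chain_comp_holomorphic:
  assumes "\<And>k. T k holomorphic_on \<Omega>" "\<And>k. inj_on (T k) \<Omega>" "\<And>k. T k ` \<Omega> \<subseteq> \<Omega>"
  shows "chain_comp T k n holomorphic_on \<Omega>" "inj_on (chain_comp T k n) \<Omega>"
    "chain_comp T k n ` \<Omega> \<subseteq> \<Omega>"
proof (induction n)
  case 0
  show "chain_comp T k 0 holomorphic_on \<Omega>" "inj_on (chain_comp T k 0) \<Omega>"
    "chain_comp T k 0 ` \<Omega> \<subseteq> \<Omega>" by (simp_all add: id_def)
next
  case (Suc n)
  show "chain_comp T k (Suc n) holomorphic_on \<Omega>"
    using holomorphic_on_compose_gen[OF Suc(1) assms(1) Suc(3)] by simp
  show "inj_on (chain_comp T k (Suc n)) \<Omega>"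
    using comp_inj_on[OF Suc(2) inj_on_subset[OF assms(2) Suc(3)]] by simp
  show "chain_comp T k (Suc n) ` \<Omega> \<subseteq> \<Omega>"
    using Suc(3) assms(3)[of "k + n"] by (auto simp: image_subset_iff)
qed

text \<open>The composites from copy \<open>k\<close> to copy \<open>j\<close> are normalised by an
  affine map depending on \<open>j\<close> alone, so compatibility in \<open>k\<close> survives. At
  \<open>a k\<close> the functions \<open>h j k\<close> then have value \<open>0\<close> and
  derivative \<open>1 / d k\<close> for all \<open>j \<ge> k\<close>. They form a normal family, and
  a diagonal limit over \<open>j\<close> gives all \<open>H k\<close> at once.\<close>

lemma univalent_direct_limit:
  fixes T :: "nat \<Rightarrow> complex \<Rightarrow> complex"
  assumes \<Omega>: "open \<Omega>" "connected \<Omega>" "\<Omega> \<noteq> {}"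
    and T: "\<And>k. T k holomorphic_on \<Omega>" "\<And>k. inj_on (T k) \<Omega>" "\<And>k. T k ` \<Omega> \<subseteq> \<Omega>"
  obtains H where "\<And>k. H k holomorphic_on \<Omega>" "\<And>k. inj_on (H k) \<Omega>"
    "\<And>k z. z \<in> \<Omega> \<Longrightarrow> H (Suc k) (T k z) = H k z"
proof -
  have chain: "chain_comp T k n holomorphic_on \<Omega>" "inj_on (chain_comp T k n) \<Omega>"
    "chain_comp T k n ` \<Omega> \<subseteq> \<Omega>" for k n
    using chain_comp_holomorphic[of T \<Omega>] T by auto
  obtain p where p: "p \<in> \<Omega>" using \<Omega> by blast
  define a where "a j = chain_comp T 0 j p" for j
  define d where "d j = deriv (chain_comp T 0 j) p" for j
  define h where "h j k z = (chain_comp T k (j - k) z - a j) / d j" for j k z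
  have a: "a k \<in> \<Omega>" for k using chain(3)[of 0 k] p by (auto simp: a_def)
  have d0: "d j \<noteq> 0" for j
    unfolding d_def by (rule holomorphic_injective_imp_regular[OF chain(1) \<Omega>(1) chain(2) p])
  have h_hol: "h j k holomorphic_on \<Omega>" for j k
    unfolding h_def using d0 by (intro holomorphic_intros chain) auto
  have h_inj: "inj_on (h j k) \<Omega>" for j k
    using chain(2)[of k "j - k"] d0[of j] by (auto simp: h_def inj_on_def)
  have hT: "h j (Suc k) (T k z) = h j k z" if "Suc k \<le> j" for j k z
  proof -
    have "j - k = Suc (j - Suc k)" using that by simp
    then show ?thesis
      using fun_cong[OF chain_comp_shift[of T k "j - Suc k"], of z] by (simp add: h_def)
  qed
  have split: "chain_comp T k (j - k) (chain_comp T 0 k z) = chain_comp T 0 j z" if "k \<le> j" for j k z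
    using chain_comp_add[of T 0 k "j - k"] that by simp
  have ha: "h j k (a k) = 0" if "k \<le> j" for j k
    using split[OF that] by (simp add: h_def a_def)
  \<comment> \<open>Composing \<open>h j k\<close> with the chain from copy \<open>0\<close> to copy
    \<open>k\<close> gives the normalised chain from \<open>0\<close> to \<open>j\<close>, whose
    derivative at \<open>p\<close> is \<open>1\<close>; the chain rule yields the rest.\<close>
  have hd: "deriv (h j k) (a k) = 1 / d k" if "k \<le> j" for j k
  proof -
    have c: "(chain_comp T 0 i has_field_derivative d i) (at p)" for i
      unfolding d_def by (rule holomorphic_derivI[OF chain(1) \<Omega>(1) p])
    have "(h j k has_field_derivative deriv (h j k) (a k)) (at (chain_comp T 0 k p))"
      using holomorphic_derivI[OF h_hol \<Omega>(1) a] by (simp add: a_def)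
    from DERIV_chain2[OF this c]
    have "((\<lambda>z. h j k (chain_comp T 0 k z)) has_field_derivative deriv (h j k) (a k) * d k) (at p)" .
    moreover have "((\<lambda>z. (chain_comp T 0 j z - a j) / d j) has_field_derivative d j / d j) (at p)"
      using DERIV_cdivide[OF DERIV_diff[OF c[of j] DERIV_const[of "a j"]], of "d j"] by simp
    then have "((\<lambda>z. h j k (chain_comp T 0 k z)) has_field_derivative 1) (at p)"
      using split[OF that] d0[of j] by (simp add: h_def)
    ultimately have "deriv (h j k) (a k) * d k = 1" by (rule DERIV_unique)
    then show ?thesis using d0[of k] by (simp add: field_simps)
  qed
  define P where "P k s \<longleftrightarrow> (\<exists>g. g holomorphic_on \<Omega> \<and>
      (\<forall>K. compact K \<and> K \<subseteq> \<Omega> \<longrightarrow> uniform_limit K (\<lambda>i. h (s i) k) g sequentially))"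
    for k and s :: "nat \<Rightarrow> nat"
  text \<open>Diagonal extraction; only the indices \<open>j \<ge> k\<close> are meaningful in \<open>h j k\<close>.\<close>
  interpret subseqs P
  proof
    fix k and s :: "nat \<Rightarrow> nat" assume s: "strict_mono s"
    define \<F> where "\<F> = {h j k |j. k \<le> j}"
    have \<F>: "f holomorphic_on \<Omega> \<and> inj_on f \<Omega> \<and> norm (f (a k)) \<le> norm (1 / d k) \<and>
        norm (deriv f (a k)) \<le> norm (1 / d k)" if "f \<in> \<F>" for f
      using that h_hol h_inj by (auto simp: \<F>_def ha hd)
    have ge: "k \<le> s (i + k)" for i
      using seq_suble[OF s, of "i + k"] by simp
    obtain g r where g: "g holomorphic_on \<Omega>" "strict_mono r"
        "\<And>K. compact K \<Longrightarrow> K \<subseteq> \<Omega> \<Longrightarrow> uniform_limit K ((\<lambda>i. h (s (i + k)) k) \<circ> r) g sequentially"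
    proof (rule Montel[OF \<Omega>(1), of \<F> "\<lambda>i. h (s (i + k)) k"])
      show "\<exists>B. \<forall>h\<in>\<F>. \<forall>z\<in>K. norm (h z) \<le> B" if "compact K" "K \<subseteq> \<Omega>" for K
        by (rule univalent_family_locally_bounded[OF \<Omega>(1,2) a \<F> that])
      show "range (\<lambda>i. h (s (i + k)) k) \<subseteq> \<F>" using ge by (auto simp: \<F>_def)
    qed (use \<F> in auto)
    have "strict_mono (\<lambda>i. r i + k)" using g(2) by (simp add: strict_mono_def)
    moreover have "P k (s \<circ> (\<lambda>i. r i + k))"
      unfolding P_def using g by (intro exI[of _ g]) (auto simp: o_def)
    ultimately show "\<exists>r'. strict_mono r' \<and> P k (s \<circ> r')" by blast
  qed
  \<comment> \<open>From index \<open>Suc k\<close> on, the diagonal sequence is a subsequence of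
    the one extracted for \<open>k\<close>, so stability of \<open>P k\<close> under subsequences is
    enough.\<close>
  have "P k (diagseq \<circ> (+) (Suc k))" for k
  proof (rule diagseq_holds)
    fix r s :: "nat \<Rightarrow> nat" and k assume r: "strict_mono r" "P k s"
    then obtain g where g: "g holomorphic_on \<Omega>"
        "\<And>K. compact K \<Longrightarrow> K \<subseteq> \<Omega> \<Longrightarrow> uniform_limit K (\<lambda>i. h (s i) k) g sequentially"
      by (auto simp: P_def)
    have "uniform_limit K (\<lambda>i. h (s (r i)) k) g sequentially" if "compact K" "K \<subseteq> \<Omega>" for K
      using filterlim_compose[OF g(2)[OF that] filterlim_subseq[OF r(1)]] .
    then show "P k (s \<circ> r)" unfolding P_def using g(1) by auto
  qed
  then have "\<forall>k. \<exists>g. g holomorphic_on \<Omega> \<and>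
      (\<forall>K. compact K \<and> K \<subseteq> \<Omega> \<longrightarrow> uniform_limit K (\<lambda>i. h (diagseq (Suc k + i)) k) g sequentially)"
    by (simp add: P_def o_def)
  then obtain H where H: "\<And>k. H k holomorphic_on \<Omega>"
      "\<And>k K. compact K \<Longrightarrow> K \<subseteq> \<Omega> \<Longrightarrow> uniform_limit K (\<lambda>i. h (diagseq (Suc k + i)) k) (H k) sequentially"
    by metis
  have ge: "Suc k \<le> diagseq (Suc k + i)" for k i
    using seq_suble[OF subseq_diagseq, of "Suc k + i"] by simp
  have lim: "(\<lambda>i. h (diagseq (Suc k + i)) k z) \<longlonglongrightarrow> H k z" if "z \<in> \<Omega>" for k z
    using tendsto_uniform_limitI[OF H(2)[of "{z}"], of z k] that by simp
  show ?thesis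
  proof
    show "H k holomorphic_on \<Omega>" for k by (rule H)
    show "H (Suc k) (T k z) = H k z" if z: "z \<in> \<Omega>" for k z
    proof -
      have "(\<lambda>i. h (diagseq (Suc (Suc k) + i)) (Suc k) (T k z)) \<longlonglongrightarrow> H (Suc k) (T k z)"
        using T(3)[of k] z by (intro lim) auto
      \<comment> \<open>The sequence for \<open>Suc k\<close> starts one index later than the one
        for \<open>k\<close>; the shift \<open>Suc i\<close> realigns them and leaves the limit
        unchanged.\<close>
      moreover have "h (diagseq (Suc (Suc k) + i)) (Suc k) (T k z) = h (diagseq (Suc k + Suc i)) k z" for i
        using hT[of k "diagseq (Suc (Suc k) + i)" z] ge[of "Suc k" i] by simp
      moreover have "(\<lambda>i. h (diagseq (Suc k + Suc i)) k z) \<longlonglongrightarrow> H k z"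
        using LIMSEQ_Suc[OF lim[OF z]] .
      ultimately show ?thesis using LIMSEQ_unique by simp
    qed
    fix k
    \<comment> \<open>Derivatives converge as well, so \<open>H k\<close> inherits the nonzero
      derivative \<open>1 / d k\<close> at \<open>a k\<close>. This excludes a constant limit, and
      Hurwitz then gives injectivity.\<close>
    have "\<exists>g'. \<forall>x\<in>\<Omega>. (H k has_field_derivative g' x) (at x) \<and>
        (\<lambda>i. deriv (h (diagseq (Suc k + i)) k) x) \<longlonglongrightarrow> g' x"
    proof (rule has_complex_derivative_uniform_sequence[OF \<Omega>(1)])
      show "(h (diagseq (Suc k + i)) k has_field_derivative deriv (h (diagseq (Suc k + i)) k) x) (at x)"
        if "x \<in> \<Omega>" for i x
        by (rule holomorphic_derivI[OF h_hol \<Omega>(1) that])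
      fix x assume "x \<in> \<Omega>"
      then obtain e where "0 < e" "cball x e \<subseteq> \<Omega>" using \<Omega>(1) open_contains_cball by blast
      then show "\<exists>d>0. cball x d \<subseteq> \<Omega> \<and>
          uniform_limit (cball x d) (\<lambda>i. h (diagseq (Suc k + i)) k) (H k) sequentially"
        using H(2)[OF compact_cball, of x e k] by (intro exI[of _ e]) auto
    qed
    then obtain G where G: "\<forall>x\<in>\<Omega>. (H k has_field_derivative G x) (at x) \<and>
        (\<lambda>i. deriv (h (diagseq (Suc k + i)) k) x) \<longlonglongrightarrow> G x" ..
    define g' where "g' = G (a k)"
    have g': "(H k has_field_derivative g') (at (a k))"
        "(\<lambda>i. deriv (h (diagseq (Suc k + i)) k) (a k)) \<longlonglongrightarrow> g'"
      using bspec[OF G a[of k]] by (auto simp: g'_def)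
    have "deriv (h (diagseq (Suc k + i)) k) (a k) = 1 / d k" for i
      using hd[of k] ge[of k i] by simp
    then have "g' = 1 / d k" using g'(2) LIMSEQ_unique by (simp add: LIMSEQ_const_iff)
    then have g'0: "g' \<noteq> 0" using d0 by simp
    show "inj_on (H k) \<Omega>"
    proof (rule Hurwitz_injective[OF \<Omega>(1,2) h_hol H(1) H(2)])
      show "\<not> H k constant_on \<Omega>"
      proof
        assume "H k constant_on \<Omega>"
        then obtain c where c: "\<And>z. z \<in> \<Omega> \<Longrightarrow> H k z = c" by (auto simp: constant_on_def)
        have "(H k has_field_derivative 0) (at (a k))"
          by (rule has_field_derivative_transform_within_open[OF DERIV_const[of c] \<Omega>(1) a])
             (use c in auto)
        then show False using g'(1) g'0 DERIV_unique by blast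
      qed
      show "inj_on (h (diagseq (Suc k + i)) k) \<Omega>" for i by (rule h_inj)
    qed auto
  qed
qed

section \<open>Exhaustions\<close>

text \<open>The lifted logarithm that computes the winding number differs from \<open>L\<close>
  along the path by a constant, and \<open>L\<close> along a closed path returns to its initial
  value.\<close>

lemma winding_number_eq_0_of_log:
  assumes p: "path p" "path_image p \<subseteq> S" "pathfinish p = pathstart p"
    and L: "continuous_on S L" "\<And>w. w \<in> S \<Longrightarrow> w - a = exp (L w)"
  shows "winding_number p a = 0"
proof -
  have "a \<notin> path_image p"
    using L(2)[of a] p(2) by auto
  then obtain q where q: "path q" "pathfinish q - pathstart q = 2 * of_real pi * \<i> * winding_number p a"
      "\<And>t. t \<in> {0..1} \<Longrightarrow> p t = a + exp (q t)"
    using winding_number_as_continuous_log[OF p(1)] by metis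
  have pS: "p t \<in> S" if "t \<in> {0..1}" for t
    using that p(2) by (auto simp: path_image_def)
  have "continuous_on {0..1} (\<lambda>t. L (p t))"
    by (rule continuous_on_compose2[OF L(1)]) (use p pS in \<open>auto simp: path_def\<close>)
  moreover have "exp (q t) = exp (L (p t))" if "t \<in> {0..1}" for t
    using q(3)[OF that] L(2)[OF pS[OF that]] by simp
  ultimately obtain n :: int where n: "\<And>t. t \<in> {0..1} \<Longrightarrow> q t = L (p t) + 2 * of_real pi * of_int n * \<i>"
    using exp_eq_imp_diff_constant[of "{0..1}" q "\<lambda>t. L (p t)"] q(1) by (auto simp: path_def)
  have "pathfinish q = pathstart q"
    using n[of 0] n[of 1] p(3) by (simp add: pathfinish_def pathstart_def)
  then show ?thesis using q(2) by simp
qed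

text \<open>By compactness a loop lies in a single stage and in all later ones, so a logarithm at
  arbitrarily late stages already makes its winding numbers vanish. In the annulus case the negation
  of \<open>log\<close> yields a point without logarithms at all late stages.\<close>

lemma simply_connected_increasing_union:
  fixes H :: "nat \<Rightarrow> complex \<Rightarrow> complex"
  assumes \<Omega>: "open \<Omega>" "connected \<Omega>"
    and H: "\<And>k. H k holomorphic_on \<Omega>" "\<And>k. inj_on (H k) \<Omega>" "\<And>k. H k ` \<Omega> \<subseteq> H (Suc k) ` \<Omega>"
    and log: "\<And>a J. a \<notin> (\<Union>k. H k ` \<Omega>) \<Longrightarrow>
      \<exists>k\<ge>J. \<exists>u. u holomorphic_on \<Omega> \<and> (\<forall>z\<in>\<Omega>. H k z - a = exp (u z))"
  shows "simply_connected (\<Union>k. H k ` \<Omega>)"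
proof -
  define G where "G = (\<Union>k. H k ` \<Omega>)"
  have openH: "open (H k ` \<Omega>)" for k
    using open_mapping_thm3[OF H(1) \<Omega>(1) H(2)] .
  have mono: "H i ` \<Omega> \<subseteq> H j ` \<Omega>" if "i \<le> j" for i j
    using lift_Suc_mono_le[of "\<lambda>k. H k ` \<Omega>"] H(3) that by blast
  have "open G" unfolding G_def using openH by blast
  moreover have "connected G"
  proof (cases "\<Omega> = {}")
    case False
    then obtain p where "p \<in> \<Omega>" by blast
    have "H 0 p \<in> (\<Inter>k. H k ` \<Omega>)" using mono[of 0] \<open>p \<in> \<Omega>\<close> by blast
    then have "(\<Inter>k. H k ` \<Omega>) \<noteq> {}" by blast
    moreover have "connected (H k ` \<Omega>)" for k
      using H(1) \<Omega>(2) connected_continuous_image holomorphic_on_imp_continuous_on by blast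
    ultimately show ?thesis
      unfolding G_def by (intro connected_Union) auto
  qed (simp add: G_def)
  moreover have "winding_number p a = 0"
    if p: "path p" "path_image p \<subseteq> G" "pathfinish p = pathstart p" and a: "a \<notin> G" for p a
  proof -
    obtain F where F: "finite F" "path_image p \<subseteq> (\<Union>k\<in>F. H k ` \<Omega>)"
      using compactE_image[OF compact_path_image[OF p(1)], of UNIV "\<lambda>k. H k ` \<Omega>"] openH p(2)
      by (auto simp: G_def)
    \<comment> \<open>The stage is chosen beyond all indices in the finite cover, so it contains the
      whole path and carries a logarithm.\<close>
    obtain k u where k: "Max (insert 0 F) \<le> k" and u: "u holomorphic_on \<Omega>"
        "\<And>z. z \<in> \<Omega> \<Longrightarrow> H k z - a = exp (u z)"
      using log[of a "Max (insert 0 F)"] a by (auto simp: G_def)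
    have "i \<le> k" if "i \<in> F" for i
      using F(1) that k by auto
    then have sub: "path_image p \<subseteq> H k ` \<Omega>"
      using F(2) mono by blast
    obtain H' where H': "H' holomorphic_on H k ` \<Omega>" "\<And>z. z \<in> \<Omega> \<Longrightarrow> H' (H k z) = z"
      using holomorphic_has_inverse[OF H(1) \<Omega>(1) H(2), of k] by metis
    show ?thesis
    proof (rule winding_number_eq_0_of_log[OF p(1) sub p(3)])
      have "(u \<circ> H') holomorphic_on H k ` \<Omega>"
        by (rule holomorphic_on_compose_gen[OF H'(1) u(1)]) (use H' in auto)
      then show "continuous_on (H k ` \<Omega>) (u \<circ> H')"
        by (rule holomorphic_on_imp_continuous_on)
      show "w - a = exp ((u \<circ> H') w)" if "w \<in> H k ` \<Omega>" for w
        using that u(2) H'(2) by auto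
    qed
  qed
  ultimately show ?thesis
    unfolding G_def[symmetric] by (simp add: simply_connected_eq_winding_number_zero)
qed

lemma biholomorphic_simply_connected:
  assumes X: "holomorphic_atlas X A" and G: "open G" "simply_connected G" "G \<noteq> {}"
    and XG: "biholomorphic X A (top_of_set G) (plane_atlas G)"
  shows "biholomorphic X A (top_of_set (ball 0 1)) (plane_atlas (ball 0 1)) \<or>
         biholomorphic X A (top_of_set UNIV) (plane_atlas UNIV)"
proof -
  consider "G = UNIV" | f g where "f holomorphic_on G" "g holomorphic_on ball 0 1"
      "\<forall>z\<in>G. f z \<in> ball 0 1 \<and> g (f z) = z" "\<forall>z\<in>ball 0 1. g z \<in> G \<and> f (g z) = z"
    using simply_connected_eq_biholomorphic_to_disc[OF G(1)] G by blast
  then show ?thesis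
  proof cases
    case 2
    then show ?thesis
      using biholomorphic_trans_plane[OF X G(1) open_ball XG, of f g 0 1] by blast
  qed (use XG in auto)
qed

section \<open>Exhaustions by simply connected domains, annuli and punctured planes\<close>

context plane_exhaustion
begin

text \<open>These are the coordinate expressions of a single univalent function on
  \<open>X\<close>.\<close>

definition planar_realization :: "(nat \<Rightarrow> complex \<Rightarrow> complex) \<Rightarrow> bool" where
  "planar_realization H \<longleftrightarrow> (\<forall>k. H k holomorphic_on \<Omega> \<and> inj_on (H k) \<Omega> \<and>
      (\<forall>z\<in>\<Omega>. H (Suc k) (transition k z) = H k z))"

lemma planar_realization_exists:
  assumes "connected \<Omega>" "\<Omega> \<noteq> {}"
  obtains H where "planar_realization H"
proof -
  obtain H where "\<And>k. H k holomorphic_on \<Omega>" "\<And>k. inj_on (H k) \<Omega>"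
    "\<And>k z. z \<in> \<Omega> \<Longrightarrow> H (Suc k) (transition k z) = H k z"
    using univalent_direct_limit[OF open_\<Omega> assms, of transition]
      transition_holomorphic transition_inj transition_in by blast
  then show ?thesis by (intro that[of H]) (simp add: planar_realization_def)
qed

lemma planar_realizationD:
  assumes "planar_realization H"
  shows "H k holomorphic_on \<Omega>" "inj_on (H k) \<Omega>"
    "z \<in> \<Omega> \<Longrightarrow> H (Suc k) (transition k z) = H k z"
    "H k ` \<Omega> \<subseteq> H (Suc k) ` \<Omega>" "open (\<Union>k. H k ` \<Omega>)"
    "biholomorphic X A (top_of_set (\<Union>k. H k ` \<Omega>)) (plane_atlas (\<Union>k. H k ` \<Omega>))"
proof -
  have H: "H k holomorphic_on \<Omega>" "inj_on (H k) \<Omega>"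
    "z \<in> \<Omega> \<Longrightarrow> H (Suc k) (transition k z) = H k z" for k z
    using assms by (auto simp: planar_realization_def)
  then show "H k holomorphic_on \<Omega>" "inj_on (H k) \<Omega>"
    "z \<in> \<Omega> \<Longrightarrow> H (Suc k) (transition k z) = H k z" by auto
  show "H k ` \<Omega> \<subseteq> H (Suc k) ` \<Omega>"
  proof
    fix w assume "w \<in> H k ` \<Omega>"
    then obtain z where "z \<in> \<Omega>" "w = H (Suc k) (transition k z)" using H(3) by auto
    then show "w \<in> H (Suc k) ` \<Omega>" using transition_in[of k] by auto
  qed
  have "open (H k ` \<Omega>)" for k
    using open_mapping_thm3[OF H(1) open_\<Omega> H(2)] .
  then show "open (\<Union>k. H k ` \<Omega>)" by blast
  show "biholomorphic X A (top_of_set (\<Union>k. H k ` \<Omega>)) (plane_atlas (\<Union>k. H k ` \<Omega>))"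
    by (rule biholomorphic_direct_limit) (use H in auto)
qed

text \<open>For \<open>a\<close> outside the union, \<open>H J z - a\<close> has no zeros on the
  simply connected \<open>\<Omega>\<close> and so has a logarithm at every stage.\<close>

lemma biholomorphic_simply_connected_exhaustion:
  assumes "simply_connected \<Omega>" "\<Omega> \<noteq> {}"
  shows "biholomorphic X A (top_of_set (ball 0 1)) (plane_atlas (ball 0 1)) \<or>
         biholomorphic X A (top_of_set UNIV) (plane_atlas UNIV)"
proof -
  have conn: "connected \<Omega>" using assms simply_connected_imp_connected by blast
  obtain H where "planar_realization H"
    by (rule planar_realization_exists[OF conn assms(2)])
  note H = planar_realizationD[OF this]
  have ne: "(\<Union>k. H k ` \<Omega>) \<noteq> {}" using assms(2) by blast
  have "simply_connected (\<Union>k. H k ` \<Omega>)"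
  proof (rule simply_connected_increasing_union[where H=H, OF open_\<Omega> conn H(1,2,4)])
    fix a J assume a: "a \<notin> (\<Union>k. H k ` \<Omega>)"
    have "(\<lambda>z. H J z - a) holomorphic_on \<Omega>" by (intro holomorphic_intros H)
    moreover have "\<forall>z\<in>\<Omega>. H J z - a \<noteq> 0" using a by auto
    ultimately have "\<exists>u. u holomorphic_on \<Omega> \<and> (\<forall>z\<in>\<Omega>. H J z - a = exp (u z))"
      using assms(1) simply_connected_eq_holomorphic_log[OF open_\<Omega>] by blast
    then show "\<exists>k\<ge>J. \<exists>u. u holomorphic_on \<Omega> \<and> (\<forall>z\<in>\<Omega>. H k z - a = exp (u z))" by blast
  qed
  then show ?thesis
    using biholomorphic_simply_connected[OF atlas H(5) _ ne H(6)] by blast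
qed

text \<open>When the union is not simply connected, some \<open>a\<close> outside it admits no
  logarithm of \<open>H k z - a\<close> at any late stage. A transition of degree \<open>0\<close>
  would produce such a logarithm, so late transitions have nonzero degree, are onto, and the
  exhaustion stabilises.\<close>

lemma biholomorphic_annulus_exhaustion:
  fixes r :: real
  assumes r: "0 < r" "r < 1" and \<Omega>: "\<Omega> = {z. r < norm z \<and> norm z < 1}"
  shows "biholomorphic X A (top_of_set \<Omega>) (plane_atlas \<Omega>) \<or>
         biholomorphic X A (top_of_set (ball 0 1)) (plane_atlas (ball 0 1)) \<or>
         biholomorphic X A (top_of_set UNIV) (plane_atlas UNIV)"
proof -
  have conn: "connected \<Omega>" using connected_annulus[OF r(1)] by (simp add: \<Omega>)
  have "complex_of_real ((r + 1) / 2) \<in> \<Omega>"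
    using r by (simp add: \<Omega> norm_of_real del: of_real_divide of_real_add)
  then have "\<Omega> \<noteq> {}" by blast
  obtain H where "planar_realization H"
    by (rule planar_realization_exists[OF conn \<open>\<Omega> \<noteq> {}\<close>])
  note H = planar_realizationD[OF this]
  have ne: "(\<Union>k. H k ` \<Omega>) \<noteq> {}" using \<open>\<Omega> \<noteq> {}\<close> by blast
  show ?thesis
  proof (cases "simply_connected (\<Union>k. H k ` \<Omega>)")
    case True
    then show ?thesis
      using biholomorphic_simply_connected[OF atlas H(5) _ ne H(6)] by blast
  next
    case False
    define Log where "Log a k \<longleftrightarrow> (\<exists>u. u holomorphic_on \<Omega> \<and> (\<forall>z\<in>\<Omega>. H k z - a = exp (u z)))"
      for a k
    have "\<not> (\<forall>a J. a \<notin> (\<Union>k. H k ` \<Omega>) \<longrightarrow> (\<exists>k\<ge>J. Log a k))"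
    proof
      assume log: "\<forall>a J. a \<notin> (\<Union>k. H k ` \<Omega>) \<longrightarrow> (\<exists>k\<ge>J. Log a k)"
      have "simply_connected (\<Union>k. H k ` \<Omega>)"
        by (rule simply_connected_increasing_union[where H=H, OF open_\<Omega> conn H(1,2,4)])
           (use log in \<open>simp add: Log_def\<close>)
      with False show False ..
    qed
    then obtain a J where a: "a \<notin> (\<Union>k. H k ` \<Omega>)" and nolog: "\<And>k. J \<le> k \<Longrightarrow> \<not> Log a k"
      by metis
    have "transition k ` \<Omega> = \<Omega>" if k: "J \<le> k" for k
    proof -
      have nz: "transition k z \<noteq> 0" if "z \<in> \<Omega>" for z
      proof -
        have "transition k z \<in> \<Omega>" using transition_in[of k] that by auto
        then show ?thesis using r by (auto simp: \<Omega>)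
      qed
      obtain m :: int and v where v: "v holomorphic_on \<Omega>"
          "\<And>z. z \<in> \<Omega> \<Longrightarrow> transition k z = z powi m * exp (v z)"
        using annulus_log_representation[OF r(1), folded \<Omega>, OF transition_holomorphic[of k] nz]
        by metis
      have Hhol: "(\<lambda>z. H (Suc k) z - a) holomorphic_on \<Omega>" by (intro holomorphic_intros H)
      have Hnz: "H (Suc k) z - a \<noteq> 0" if "z \<in> \<Omega>" for z using a that by auto
      obtain n :: int and u where u: "u holomorphic_on \<Omega>"
          "\<And>z. z \<in> \<Omega> \<Longrightarrow> H (Suc k) z - a = z powi n * exp (u z)"
        using annulus_log_representation[OF r(1), folded \<Omega>, OF Hhol Hnz] by metis
      have "m \<noteq> 0"
      \<comment> \<open>With \<open>m = 0\<close> the transition is \<open>exp (v z)\<close>;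
        substituting it into the representation of \<open>H (Suc k) z - a\<close> turns the power
        \<open>n\<close> into the summand \<open>n * v z\<close> of a logarithm.\<close>
      proof
        assume m: "m = 0"
        have "(\<lambda>z. of_int n * v z + (u \<circ> transition k) z) holomorphic_on \<Omega>"
          by (intro holomorphic_intros v
              holomorphic_on_compose_gen[OF transition_holomorphic u(1) transition_in])
        moreover have "H k z - a = exp (of_int n * v z + (u \<circ> transition k) z)" if z: "z \<in> \<Omega>" for z
        proof -
          have "transition k z \<in> \<Omega>" using transition_in[of k] z by auto
          then have "H k z - a = transition k z powi n * exp (u (transition k z))"
            using u(2)[of "transition k z"] H(3)[OF z, of k] by simp
          also have "transition k z = exp (v z)" using v(2)[OF z] m by simp
          then have "transition k z powi n = exp (of_int n * v z)" by (simp add: exp_power_int)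
          finally show ?thesis by (simp add: exp_add)
        qed
        ultimately have "Log a k" unfolding Log_def by blast
        then show False using nolog[OF k] by simp
      qed
      then show ?thesis
        using annulus_selfmap_surj[OF r, folded \<Omega>, OF transition_holomorphic[of k]
            transition_in[of k] v] by simp
    qed
    then show ?thesis using biholomorphic_stable by blast
  qed
qed

text \<open>Every transition is a univalent self-map of a finite complement, hence onto, so the
  exhaustion is constant from the start.\<close>

lemma biholomorphic_finite_complement_exhaustion:
  assumes "finite S" "\<Omega> = - S"
  shows "biholomorphic X A (top_of_set \<Omega>) (plane_atlas \<Omega>)"
proof (rule biholomorphic_stable)
  show "transition k ` \<Omega> = \<Omega>" for k
    using univalent_finite_complement_surj[OF assms(1), of "transition k"]
      transition_holomorphic[of k] transition_inj[of k] transition_in[of k]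
    unfolding assms(2) by simp
qed

end

theorem theorem1p2:
  fixes X :: "'a topology" and A :: "'a chart set"
    and \<Omega> :: "complex set" and M :: "nat \<Rightarrow> 'a set"
  assumes "riemann_surface X A"
    and "open \<Omega>" and "connected \<Omega>" and "\<Omega> \<noteq> {}"
    and "\<And>j. openin X (M j)"
    and "\<And>j. M j \<subseteq> M (Suc j)"
    and "(\<Union>j. M j) = topspace X"
    and "\<And>j. biholomorphic (subtopology X (M j)) (restrict_atlas A (M j))
                            (top_of_set \<Omega>) (plane_atlas \<Omega>)"
  shows "(\<Omega> = ball 0 1 \<longrightarrow>
            biholomorphic X A (top_of_set (ball 0 1)) (plane_atlas (ball 0 1)) \<or>
            biholomorphic X A (top_of_set UNIV) (plane_atlas UNIV))
       \<and> (\<forall>r::real. 0 < r \<and> r < 1 \<and> \<Omega> = {z. r < norm z \<and> norm z < 1} \<longrightarrow>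
            biholomorphic X A (top_of_set \<Omega>) (plane_atlas \<Omega>) \<or>
            biholomorphic X A (top_of_set (ball 0 1)) (plane_atlas (ball 0 1)) \<or>
            biholomorphic X A (top_of_set UNIV) (plane_atlas UNIV))
       \<and> (\<Omega> = UNIV \<longrightarrow> biholomorphic X A (top_of_set UNIV) (plane_atlas UNIV))
       \<and> (\<forall>S. finite S \<and> S \<noteq> {} \<and> \<Omega> = - S \<longrightarrow>
            biholomorphic X A (top_of_set \<Omega>) (plane_atlas \<Omega>))"
proof -
  have atlas: "holomorphic_atlas X A" using assms(1) by (simp add: riemann_surface_def)
  have top: "topspace (subtopology X (M j)) = M j" for j
    using openin_subset[OF assms(5)] by auto
  have "\<forall>j. \<exists>f h. holomorphic_map (subtopology X (M j)) (restrict_atlas A (M j))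
                   (top_of_set \<Omega>) (plane_atlas \<Omega>) f \<and>
        holomorphic_map (top_of_set \<Omega>) (plane_atlas \<Omega>)
                   (subtopology X (M j)) (restrict_atlas A (M j)) h \<and>
        (\<forall>x\<in>M j. h (f x) = x) \<and> (\<forall>z\<in>\<Omega>. f (h z) = z)"
    using assms(8) unfolding biholomorphic_def top topspace_euclidean_subtopology by blast
  then obtain g \<phi> where g\<phi>: "\<And>j. holomorphic_map (subtopology X (M j)) (restrict_atlas A (M j))
                   (top_of_set \<Omega>) (plane_atlas \<Omega>) (g j) \<and>
        holomorphic_map (top_of_set \<Omega>) (plane_atlas \<Omega>)
                   (subtopology X (M j)) (restrict_atlas A (M j)) (\<phi> j) \<and>
        (\<forall>x\<in>M j. \<phi> j (g j x) = x) \<and> (\<forall>z\<in>\<Omega>. g j (\<phi> j z) = z)"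
    by metis
  interpret plane_exhaustion X A \<Omega> M g \<phi>
    by unfold_locales (use atlas assms g\<phi> in auto)
  show ?thesis
  proof (intro conjI impI allI)
    assume "\<Omega> = ball 0 1"
    then show "biholomorphic X A (top_of_set (ball 0 1)) (plane_atlas (ball 0 1)) \<or>
            biholomorphic X A (top_of_set UNIV) (plane_atlas UNIV)"
      using biholomorphic_simply_connected_exhaustion assms(4)
      by (simp add: convex_imp_simply_connected)
  next
    fix r :: real assume "0 < r \<and> r < 1 \<and> \<Omega> = {z. r < norm z \<and> norm z < 1}"
    then show "biholomorphic X A (top_of_set \<Omega>) (plane_atlas \<Omega>) \<or>
            biholomorphic X A (top_of_set (ball 0 1)) (plane_atlas (ball 0 1)) \<or>
            biholomorphic X A (top_of_set UNIV) (plane_atlas UNIV)"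
      using biholomorphic_annulus_exhaustion by blast
  next
    \<comment> \<open>The plane is the complement of the empty set, where infinity is the only
      puncture.\<close>
    assume "\<Omega> = UNIV"
    then show "biholomorphic X A (top_of_set UNIV) (plane_atlas UNIV)"
      using biholomorphic_finite_complement_exhaustion[of "{}"] by simp
  next
    fix S assume "finite S \<and> S \<noteq> {} \<and> \<Omega> = - S"
    then show "biholomorphic X A (top_of_set \<Omega>) (plane_atlas \<Omega>)"
      using biholomorphic_finite_complement_exhaustion by blast
  qed
qed

end
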